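(* Let $(\mathcal{G},X,\mu)$ be an aperiodic ergodic graphing with associated unimodular random graph $(G,o)$, i.e. $(G,o)$ is the rooted connected component $(\mathcal{G}_x,x)$ of a $\mu$-random vertex $x$. Then $\sigma(G,o)\subset\sigma(\mathcal{G})$ (almost surely).
   Context: A graphing is a triple $(\mathcal{G},X,\mu)$, where $X$ is a standard Borel space, $\mathcal G\subset X\times X$ is a symmetric Borel set (a Borel graph) with all degrees bounded by some $D\in\mathbb{N}$, and $\mu$ is a Borel probability measure on $X$ satisfying the Mass Transport Principle: for every Borel $f:\mathcal{G}\to\mathbb{R}_{\ge0}$, $\int_X\sum_{y\sim x} f(y,x)\,d\mu(x)=\int_X\sum_{y\sim x} f(x,y)\,d\mu(x)$, the sums being over $\mathcal G$-neighbours $y$ of $x$. $\mathcal{G}_x$ denotes the connected component of $x$. The graphing is aperiodic if $\mathcal{G}_x$ is infinite for $\mu$-almost every $x$, and ergodic if every Borel set that is a union of connected components has measure $0$ or $1$. $\sigma(\mathcal{G})$ is the spectrum of the Markov operator $(\mathcal{M}f)(x)=\frac{1}{\deg(x)}\sum_{(x,y)\in\mathcal{G}}f(y)$ on $L^2(X,\mu^* )$, where $\int f\,d\mu^*=\int f\deg\,d\mu/\int\deg\,d\mu$. $\sigma(G,o)$ is the spectrum of the Markov operator $(M_Gf)(u)=\frac{1}{\deg(u)}\sum_{(u,v)\in E(G)}f(v)$ on $\ell^2(G,\deg)$, the functions on $V(G)$ with inner product $\langle f,g\rangle=\sum_u f(u)\overline{g(u)}\deg(u)$. *)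

theory Defs
  imports "HOL-Probability.Probability"
begin

definition standard_borel :: "'a measure \<Rightarrow> bool" where
  "standard_borel M \<longleftrightarrow>
     (\<exists>T. completely_metrizable_space T \<and> second_countable T \<and>
          space M = topspace T \<and> sets M = sigma_sets (topspace T) {U. openin T U})"

section \<open>Graphs as symmetric sets of ordered pairs\<close>

definition vdegree :: "('a \<times> 'a) set \<Rightarrow> 'a \<Rightarrow> nat" where
  "vdegree E x = card (E `` {x})"

definition component :: "('a \<times> 'a) set \<Rightarrow> 'a \<Rightarrow> 'a set" where
  "component E x = E\<^sup>* `` {x}"

definition component_edges :: "('a \<times> 'a) set \<Rightarrow> 'a \<Rightarrow> ('a \<times> 'a) set" where
  "component_edges E x = E \<inter> (component E x \<times> component E x)"

text \<open>At an isolated vertex the value is 0.\<close>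

definition markov_op :: "('a \<times> 'a) set \<Rightarrow> ('a \<Rightarrow> complex) \<Rightarrow> 'a \<Rightarrow> complex" where
  "markov_op E f x = (\<Sum>y \<in> E `` {x}. f y) / of_nat (vdegree E x)"

section \<open>Spectra of operators on \<open>L\<^sup>2\<close>\<close>

text \<open>
  Elements of the complex Hilbert space \<open>L\<^sup>2(M)\<close> are handled through representatives:
  square-integrable functions, considered equal when they agree almost everywhere.
  An operator on \<open>L\<^sup>2(M)\<close> is a map on representatives that respects this equality.
\<close>

definition L2 :: "'a measure \<Rightarrow> ('a \<Rightarrow> complex) set" where
  "L2 M = {f \<in> borel_measurable M. integrable M (\<lambda>x. (cmod (f x))\<^sup>2)}"

definition L2norm :: "'a measure \<Rightarrow> ('a \<Rightarrow> complex) \<Rightarrow> real" where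
  "L2norm M f = sqrt (\<integral>x. (cmod (f x))\<^sup>2 \<partial>M)"

definition bounded_L2_operator ::
    "'a measure \<Rightarrow> (('a \<Rightarrow> complex) \<Rightarrow> ('a \<Rightarrow> complex)) \<Rightarrow> bool" where
  "bounded_L2_operator M S \<longleftrightarrow>
     (\<forall>f\<in>L2 M. S f \<in> L2 M) \<and>
     (\<forall>f\<in>L2 M. \<forall>g\<in>L2 M. (AE x in M. f x = g x) \<longrightarrow> (AE x in M. S f x = S g x)) \<and>
     (\<forall>f\<in>L2 M. \<forall>g\<in>L2 M. AE x in M. S (\<lambda>y. f y + g y) x = S f x + S g x) \<and>
     (\<forall>c. \<forall>f\<in>L2 M. AE x in M. S (\<lambda>y. c * f y) x = c * S f x) \<and>
     (\<exists>C. \<forall>f\<in>L2 M. L2norm M (S f) \<le> C * L2norm M f)"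

text \<open>
  The spectrum of a bounded operator \<open>T\<close> on \<open>L\<^sup>2(M)\<close>: all complex \<open>c\<close> for which
  \<open>c I - T\<close> has no bounded two-sided inverse.
\<close>

definition L2_spectrum ::
    "'a measure \<Rightarrow> (('a \<Rightarrow> complex) \<Rightarrow> ('a \<Rightarrow> complex)) \<Rightarrow> complex set" where
  "L2_spectrum M T =
     {c. \<not> (\<exists>S. bounded_L2_operator M S \<and>
              (\<forall>f\<in>L2 M. (AE x in M. S (\<lambda>y. c * f y - T f y) x = f x) \<and>
                        (AE x in M. c * S f x - T (S f) x = f x)))}"

text \<open>
  \<open>\<ell>\<^sup>2(G, deg)\<close> is \<open>L\<^sup>2\<close> of the measure on the vertex set \<open>V\<close> in which the vertex \<open>u\<close>
  has mass \<open>deg u\<close>.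
\<close>

definition graph_spectrum :: "'a set \<Rightarrow> ('a \<times> 'a) set \<Rightarrow> complex set" where
  "graph_spectrum V E =
     L2_spectrum (point_measure V (\<lambda>u. ennreal (real (vdegree E u)))) (markov_op E)"

section \<open>Graphings\<close>

locale graphing = prob_space M for M :: "'a measure" +
  fixes E :: "('a \<times> 'a) set"
  assumes standard_borel: "standard_borel M"
    and borel_edges: "E \<in> sets (M \<Otimes>\<^sub>M M)"
    and sym_edges: "sym E"
    and bounded_degree:
      "\<exists>D. \<forall>x\<in>space M. finite (E `` {x}) \<and> vdegree E x \<le> D"
    and mass_transport:
      "\<And>f :: 'a \<times> 'a \<Rightarrow> real.
         f \<in> borel_measurable (restrict_space (M \<Otimes>\<^sub>M M) E) \<Longrightarrow>
         (\<And>p. p \<in> E \<Longrightarrow> 0 \<le> f p) \<Longrightarrow>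
         (\<integral>\<^sup>+x. (\<Sum>y \<in> E `` {x}. ennreal (f (y, x))) \<partial>M) =
         (\<integral>\<^sup>+x. (\<Sum>y \<in> E `` {x}. ennreal (f (x, y))) \<partial>M)"

definition aperiodic :: "'a measure \<Rightarrow> ('a \<times> 'a) set \<Rightarrow> bool" where
  "aperiodic M E \<longleftrightarrow> (AE x in M. infinite (component E x))"

definition ergodic :: "'a measure \<Rightarrow> ('a \<times> 'a) set \<Rightarrow> bool" where
  "ergodic M E \<longleftrightarrow>
     (\<forall>A\<in>sets M. (\<exists>B\<subseteq>space M. A = (\<Union>x\<in>B. component E x)) \<longrightarrow>
        measure M A = 0 \<or> measure M A = 1)"

text \<open>The degree-biased probability measure \<open>\<mu>\<^sup>*\<close>.\<close>

definition degree_biased :: "'a measure \<Rightarrow> ('a \<times> 'a) set \<Rightarrow> 'a measure" where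
  "degree_biased M E =
     density M (\<lambda>x. ennreal (real (vdegree E x) / (\<integral>z. real (vdegree E z) \<partial>M)))"

definition graphing_spectrum :: "'a measure \<Rightarrow> ('a \<times> 'a) set \<Rightarrow> complex set" where
  "graphing_spectrum M E = L2_spectrum (degree_biased M E) (markov_op E)"

end

theory Submission
  imports Defs
begin

text \<open>
  Write \<open>\<M>\<close> for either Markov operator. If \<open>c\<close> is outside the spectrum of the graphing, the bounded
  inverse of \<open>c - \<M>\<close> yields a constant \<open>C\<close> with \<open>\<parallel>F\<parallel> \<le> C \<parallel>(c - \<M>) F\<parallel>\<close> in \<open>L\<^sup>2(\<mu>\<^sup>*)\<close>. For almost every
  \<open>x\<close> this estimate is inherited, with the same \<open>C\<close>, by all finitely supported functions on the component
  of \<open>x\<close>. On a graph such an estimate already implies that \<open>c\<close> is outside the spectrum. The exceptional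
  null set depends on neither \<open>c\<close> nor the function, so all \<open>c\<close> are treated at once.

  \<^emph>\<open>Inheriting the estimate\<close> (\<open>energy_bound\<close>). Let \<open>g\<close> be supported in the ball of radius \<open>r\<close>
  around \<open>x\<close>. Label the points of \<open>X\<close> by natural numbers in a Borel way, injectively on every ball of radius
  \<open>r + 2\<close> (\<open>locally_injective_labelling\<close>), and let the type of \<open>x\<close> record the labels in the balls around
  \<open>x\<close> together with the labels adjacent to each of them. There are countably many types, hence for almost
  every \<open>x\<close> the set of points sharing the type of \<open>x\<close> has positive measure. Every point within distance
  \<open>r + 1\<close> of this set is a copy of the vertex with the same label in the ball around \<open>x\<close>. Transplanting \<open>g\<close> to
  the copies gives a function \<open>F\<close> on \<open>X\<close>, and \<open>(c - \<M>) F\<close> is the transplant of \<open>(c - \<M>) g\<close>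
  (\<open>markov_op_spread\<close>). The mass transport principle, applied to one edge at a time, shows that all vertices
  have copies of equal total measure (\<open>emeasure_cell\<close>). Consequently both squared norms are those of \<open>g\<close> and
  \<open>(c - \<M>) g\<close> multiplied by one and the same positive factor, and the estimate for \<open>F\<close> is the estimate for \<open>g\<close>.

  \<^emph>\<open>From the estimate to invertibility\<close> (\<open>not_in_graph_spectrum\<close>). Let \<open>A = c - \<M>\<close>. As \<open>\<M>\<close> is self-adjoint
  and bounded, the estimate makes \<open>B = I - t A\<^sup>* A\<close> a strict contraction for a small \<open>t > 0\<close>, and
  \<open>\<Sum>n. t B\<^sup>n A\<^sup>*\<close> is a two-sided inverse of \<open>A\<close>. The graph is locally finite, so every identity between
  these operators can be checked pointwise.

  \<^emph>\<open>Measurability.\<close> Types are described by sets of neighbours of Borel sets, which are projections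
  of Borel sets with sections of bounded size. Such projections are Borel
  (\<open>measurable_projection_bounded_sections\<close>) by a uniformization argument based on Lusin's separation theorem.
\<close>

section \<open>Analytic sets and Lusin separation\<close>

text \<open>
  Continuous images of closed subsets of the Baire space. Admitting closed sets, rather than only the
  whole space, includes the empty set and makes the closure properties immediate.
\<close>

definition analytic_set :: "'a::topological_space set \<Rightarrow> bool" where
  "analytic_set A \<longleftrightarrow>
     (\<exists>(C :: (nat \<Rightarrow> nat) set) f. closed C \<and> continuous_on C f \<and> A = f ` C)"

lemma analytic_set_image:
  assumes "analytic_set A" "continuous_on UNIV g"
  shows "analytic_set (g ` A)"
proof -
  obtain C :: "(nat \<Rightarrow> nat) set" and f where C: "closed C" "continuous_on C f" "A = f ` C"
    using assms(1) unfolding analytic_set_def by blast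
  have "continuous_on C (g \<circ> f)"
    by (intro continuous_on_compose C continuous_on_subset[OF assms(2)]) auto
  then show ?thesis
    unfolding analytic_set_def using C by (intro exI[of _ C] exI[of _ "g \<circ> f"]) (auto simp: image_comp)
qed

lemma open_coordinate_eq: "open {\<alpha> :: nat \<Rightarrow> nat. \<alpha> i = a}"
proof -
  have "open ((\<lambda>\<alpha> :: nat \<Rightarrow> nat. \<alpha> i) -` {a})"
    by (rule open_vimage[OF discrete_topology_class.open_discrete continuous_on_product_coordinates])
  then show ?thesis by (simp add: vimage_def)
qed

lemma closed_coordinates_Collect: "closed {\<alpha> :: nat \<Rightarrow> nat. P (\<alpha> i) (\<alpha> j)}"
proof -
  have "open (\<Union>(a, b) \<in> {(a, b). \<not> P a b}. {\<alpha> :: nat \<Rightarrow> nat. \<alpha> i = a} \<inter> {\<alpha>. \<alpha> j = b})"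
    by (intro open_UN ballI) (auto intro!: open_Int open_coordinate_eq)
  moreover have "(\<Union>(a, b) \<in> {(a, b). \<not> P a b}. {\<alpha> :: nat \<Rightarrow> nat. \<alpha> i = a} \<inter> {\<alpha>. \<alpha> j = b})
      = - {\<alpha>. P (\<alpha> i) (\<alpha> j)}"
    by auto
  ultimately show ?thesis by (simp add: closed_def)
qed

lemma continuous_on_reindex: "continuous_on A (\<lambda>\<alpha> :: nat \<Rightarrow> nat. \<lambda>k. \<alpha> (s k))"
  by (rule continuous_on_subset[OF _ subset_UNIV])
    (intro continuous_on_coordinatewise_then_product continuous_on_product_coordinates)

text \<open>
  The first coordinate of a code selects the set, the remaining coordinates code a point of it.
\<close>

lemma analytic_set_UN:
  fixes A :: "nat \<Rightarrow> 'a::topological_space set"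
  assumes "\<And>n. analytic_set (A n)"
  shows "analytic_set (\<Union>n. A n)"
proof -
  have "\<forall>n. \<exists>C f. closed (C :: (nat \<Rightarrow> nat) set) \<and> continuous_on C f \<and> A n = f ` C"
    using assms unfolding analytic_set_def by blast
  then obtain C f where C: "\<And>n. closed (C n :: (nat \<Rightarrow> nat) set)" "\<And>n. continuous_on (C n) (f n)"
      "\<And>n. A n = f n ` C n"
    by metis
  define tl where "tl = (\<lambda>\<alpha> :: nat \<Rightarrow> nat. \<lambda>k. \<alpha> (Suc k))"
  define D where "D = {\<alpha>. tl \<alpha> \<in> C (\<alpha> 0)}"
  define g where "g = (\<lambda>\<alpha>. f (\<alpha> 0) (tl \<alpha>))"
  have tl: "continuous_on S tl" for S
    unfolding tl_def by (rule continuous_on_reindex)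
  have open0: "open {\<alpha> :: nat \<Rightarrow> nat. \<alpha> 0 = a}" for a by (rule open_coordinate_eq)
  have "- D = (\<Union>a. {\<alpha>. \<alpha> 0 = a} \<inter> tl -` (- C a))"
    by (auto simp: D_def)
  moreover have "open (\<Union>a. {\<alpha>. \<alpha> 0 = a} \<inter> tl -` (- C a))"
    by (intro open_UN ballI open_Int open0 open_vimage tl) (use C in auto)
  ultimately have "closed D" by (simp add: closed_def)
  moreover have "continuous_on D g"
    unfolding continuous_on_open_invariant
  proof (intro allI impI)
    fix B :: "'a set" assume "open B"
    have "\<exists>U. open U \<and> U \<inter> (D \<inter> {\<alpha>. \<alpha> 0 = a}) = g -` B \<inter> (D \<inter> {\<alpha>. \<alpha> 0 = a})" for a
    proof -
      have "continuous_on (D \<inter> {\<alpha>. \<alpha> 0 = a}) (\<lambda>\<alpha>. f a (tl \<alpha>))"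
        by (rule continuous_on_compose2[OF C(2)[of a] tl]) (auto simp: D_def)
      then have "continuous_on (D \<inter> {\<alpha>. \<alpha> 0 = a}) g"
        by (rule continuous_on_eq) (auto simp: g_def)
      then show ?thesis using \<open>open B\<close> unfolding continuous_on_open_invariant by blast
    qed
    then obtain U where U: "\<And>a. open (U a)"
      "\<And>a. U a \<inter> (D \<inter> {\<alpha>. \<alpha> 0 = a}) = g -` B \<inter> (D \<inter> {\<alpha>. \<alpha> 0 = a})"
      by metis
    have "open (\<Union>a. U a \<inter> {\<alpha>. \<alpha> 0 = a})"
      by (intro open_UN ballI open_Int U open0)
    moreover have "(\<Union>a. U a \<inter> {\<alpha>. \<alpha> 0 = a}) \<inter> D = g -` B \<inter> D"
      using U(2) by blast
    ultimately show "\<exists>U. open U \<and> U \<inter> D = g -` B \<inter> D" by blast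
  qed
  moreover have "(\<Union>n. A n) = g ` D"
  proof (intro equalityI subsetI)
    fix x assume "x \<in> (\<Union>n. A n)"
    then obtain n \<alpha> where "\<alpha> \<in> C n" "x = f n \<alpha>" using C(3) by auto
    then have "(\<lambda>k. case k of 0 \<Rightarrow> n | Suc k \<Rightarrow> \<alpha> k) \<in> D" "x = g (\<lambda>k. case k of 0 \<Rightarrow> n | Suc k \<Rightarrow> \<alpha> k)"
      by (auto simp: D_def g_def tl_def)
    then show "x \<in> g ` D" by blast
  next
    fix x assume "x \<in> g ` D"
    then show "x \<in> (\<Union>n. A n)" by (auto simp: D_def g_def C(3))
  qed
  ultimately show ?thesis unfolding analytic_set_def by blast
qed

text \<open>
  A code is a matrix whose \<open>n\<close>-th row codes a point of the \<open>n\<close>-th set. In a Hausdorff space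
  the requirement that all rows code the same point is closed.
\<close>

lemma analytic_set_INT:
  fixes A :: "nat \<Rightarrow> 'a::t2_space set"
  assumes "\<And>n. analytic_set (A n)"
  shows "analytic_set (\<Inter>n. A n)"
proof -
  have "\<forall>n. \<exists>C f. closed (C :: (nat \<Rightarrow> nat) set) \<and> continuous_on C f \<and> A n = f ` C"
    using assms unfolding analytic_set_def by blast
  then obtain C f where C: "\<And>n. closed (C n :: (nat \<Rightarrow> nat) set)" "\<And>n. continuous_on (C n) (f n)"
      "\<And>n. A n = f n ` C n"
    by metis
  define row where "row = (\<lambda>n. \<lambda>\<alpha> :: nat \<Rightarrow> nat. \<lambda>k. \<alpha> (prod_encode (n, k)))"
  have row: "continuous_on S (row n)" for S n
    unfolding row_def by (rule continuous_on_reindex)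
  define D where "D = (\<Inter>n. row n -` C n)"
  have D: "closed D"
    unfolding D_def by (intro closed_INT ballI closed_vimage row) (use C in auto)
  have fc: "continuous_on D (\<lambda>\<alpha>. f n (row n \<alpha>))" for n
    by (rule continuous_on_compose2[OF C(2)[of n] row]) (auto simp: D_def)
  define K where "K = (\<Inter>n. D \<inter> (\<lambda>\<alpha>. (f n (row n \<alpha>), f 0 (row 0 \<alpha>))) -` {p. fst p = snd p})"
  have "closed K"
    unfolding K_def
  proof (intro closed_INT ballI continuous_closed_preimage)
    show "closed {p :: 'a \<times> 'a. fst p = snd p}"
      by (intro closed_Collect_eq continuous_intros)
  qed (intro continuous_intros fc D)+
  moreover have "continuous_on K (\<lambda>\<alpha>. f 0 (row 0 \<alpha>))"
    by (rule continuous_on_subset[OF fc]) (auto simp: K_def)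
  moreover have "(\<Inter>n. A n) = (\<lambda>\<alpha>. f 0 (row 0 \<alpha>)) ` K"
  proof (intro equalityI subsetI)
    fix x assume x: "x \<in> (\<Inter>n. A n)"
    have "\<forall>n. \<exists>\<beta>. \<beta> \<in> C n \<and> x = f n \<beta>"
      using x C(3) by auto
    then obtain \<beta> where \<beta>: "\<And>n. \<beta> n \<in> C n" "\<And>n. x = f n (\<beta> n)" by metis
    define \<alpha> where "\<alpha> = (\<lambda>k. case prod_decode k of (n, j) \<Rightarrow> \<beta> n j)"
    have "row n \<alpha> = \<beta> n" for n by (auto simp: row_def \<alpha>_def)
    then have "\<alpha> \<in> K" "x = f 0 (row 0 \<alpha>)"
      using \<beta> by (auto simp: K_def D_def)
    then show "x \<in> (\<lambda>\<alpha>. f 0 (row 0 \<alpha>)) ` K" by blast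
  next
    fix x assume "x \<in> (\<lambda>\<alpha>. f 0 (row 0 \<alpha>)) ` K"
    then obtain \<alpha> where \<alpha>: "\<alpha> \<in> K" "x = f 0 (row 0 \<alpha>)" by blast
    show "x \<in> (\<Inter>n. A n)"
    proof
      fix n
      have "f n (row n \<alpha>) = f 0 (row 0 \<alpha>)" "row n \<alpha> \<in> C n" using \<alpha>(1) by (auto simp: K_def D_def)
      then have "x = f n (row n \<alpha>)" "row n \<alpha> \<in> C n" using \<alpha>(2) by auto
      then show "x \<in> A n" using C(3) by auto
    qed
  qed
  ultimately show ?thesis unfolding analytic_set_def by blast
qed

text \<open>
  A point is coded by a sequence of indices into a countable dense set along which consecutive distances
  decay geometrically; completeness provides the limit.
\<close>

lemma analytic_set_UNIV: "analytic_set (UNIV :: 'a::{complete_space, second_countable_topology} set)"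
proof -
  obtain Q :: "'a set" where Q: "countable Q" "\<And>X. open X \<Longrightarrow> X \<noteq> {} \<Longrightarrow> \<exists>d\<in>Q. d \<in> X"
    by (rule countable_dense_setE) auto
  have "Q \<noteq> {}" using Q(2)[of UNIV] by auto
  then have ran: "range (from_nat_into Q) = Q" using Q(1) by simp
  define q where "q = from_nat_into Q"
  have dense: "\<exists>i. dist (q i) x < e" if "e > 0" for e x
  proof -
    have "open (ball x e)" "ball x e \<noteq> {}" using that by auto
    then obtain d where "d \<in> Q" "d \<in> ball x e" using Q(2)[of "ball x e"] by blast
    moreover obtain i where "d = q i" using \<open>d \<in> Q\<close> ran unfolding q_def by blast
    ultimately show ?thesis by (auto simp: dist_commute)
  qed
  define C where "C = {\<alpha> :: nat \<Rightarrow> nat. \<forall>j. dist (q (\<alpha> j)) (q (\<alpha> (Suc j))) \<le> (1/2) ^ j}"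
  have "C = (\<Inter>j. {\<alpha>. dist (q (\<alpha> j)) (q (\<alpha> (Suc j))) \<le> (1/2) ^ j})"
    by (auto simp: C_def)
  then have "closed C"
    by (simp only:) (intro closed_INT ballI closed_coordinates_Collect)
  have step: "dist (q (\<alpha> j)) (q (\<alpha> (j + k))) \<le> 2 * (1/2) ^ j - 2 * (1/2) ^ (j + k)" if "\<alpha> \<in> C" for \<alpha> j k
  proof (induction k)
    case (Suc k)
    have "dist (q (\<alpha> (j + k))) (q (\<alpha> (Suc (j + k)))) \<le> (1/2) ^ (j + k)"
      using that by (auto simp: C_def)
    then show ?case
      using Suc dist_triangle[of "q (\<alpha> j)" "q (\<alpha> (Suc (j + k)))" "q (\<alpha> (j + k))"] by simp
  qed simp
  have step': "dist (q (\<alpha> j)) (q (\<alpha> k)) \<le> 2 * (1/2) ^ j" if "\<alpha> \<in> C" "j \<le> k" for \<alpha> j k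
    using step[OF that(1), of j "k - j"] that(2) by (smt (verit) le_add_diff_inverse zero_le_power half_gt_zero)
  have small: "\<exists>j. 2 * (1/2) ^ j < e" if "e > 0" for e :: real
    using real_arch_pow_inv[of "e / 2" "1/2"] that by (auto simp: field_simps)
  define f where "f = (\<lambda>\<alpha>. lim (\<lambda>j. q (\<alpha> j)))"
  have conv: "(\<lambda>j. q (\<alpha> j)) \<longlonglongrightarrow> f \<alpha>" if "\<alpha> \<in> C" for \<alpha>
  proof -
    have "Cauchy (\<lambda>j. q (\<alpha> j))"
    proof (rule metric_CauchyI)
      fix e :: real assume "e > 0"
      then obtain j where j: "2 * (1/2) ^ j < e / 2" using small[of "e/2"] by auto
      have "dist (q (\<alpha> m)) (q (\<alpha> n)) < e" if "m \<ge> j" "n \<ge> j" for m n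
        using step'[OF \<open>\<alpha> \<in> C\<close> that(1)] step'[OF \<open>\<alpha> \<in> C\<close> that(2)] j
          dist_triangle2[of "q (\<alpha> m)" "q (\<alpha> n)" "q (\<alpha> j)"] by (smt (verit) dist_commute field_sum_of_halves)
      then show "\<exists>M. \<forall>m\<ge>M. \<forall>n\<ge>M. dist (q (\<alpha> m)) (q (\<alpha> n)) < e" by blast
    qed
    then show ?thesis by (simp add: f_def Cauchy_convergent_iff convergent_LIMSEQ_iff)
  qed
  have fdist: "dist (q (\<alpha> j)) (f \<alpha>) \<le> 2 * (1/2) ^ j" if "\<alpha> \<in> C" for \<alpha> j
  proof (rule Lim_bounded)
    show "(\<lambda>k. dist (q (\<alpha> j)) (q (\<alpha> k))) \<longlonglongrightarrow> dist (q (\<alpha> j)) (f \<alpha>)"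
      by (intro tendsto_intros conv that)
  qed (use step' that in auto)
  have "continuous_on C f"
  proof (rule uniform_limit_theorem)
    show "uniform_limit C (\<lambda>j \<alpha>. q (\<alpha> j)) f sequentially"
    proof (rule uniform_limitI)
      fix e :: real assume "e > 0"
      then obtain j where j: "2 * (1/2) ^ j < e" using small by auto
      have "dist (q (\<alpha> k)) (f \<alpha>) < e" if "k \<ge> j" "\<alpha> \<in> C" for k \<alpha>
      proof -
        have "(1/2) ^ k \<le> (1/2 :: real) ^ j" using that(1) by (intro power_decreasing) auto
        then show ?thesis using fdist[OF that(2), of k] j by linarith
      qed
      then show "\<forall>\<^sub>F k in sequentially. \<forall>\<alpha>\<in>C. dist (q (\<alpha> k)) (f \<alpha>) < e"
        by (auto simp: eventually_sequentially)
    qed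
    show "\<forall>\<^sub>F j in sequentially. continuous_on C (\<lambda>\<alpha>. q (\<alpha> j))"
    proof (intro always_eventually allI)
      fix j
      show "continuous_on C (\<lambda>\<alpha>. q (\<alpha> j))"
        by (rule continuous_on_compose2[of UNIV q])
          (auto intro: continuous_on_subset[OF continuous_on_product_coordinates] continuous_on_discrete)
    qed
  qed simp
  moreover have "UNIV = f ` C"
  proof (intro equalityI subsetI)
    fix x :: 'a
    have "\<forall>j. \<exists>i. dist (q i) x < (1/2) ^ (j + 2)" by (intro allI dense) simp
    then obtain \<alpha> where \<alpha>: "\<And>j. dist (q (\<alpha> j)) x < (1/2) ^ (j + 2)" by metis
    have "dist (q (\<alpha> j)) (q (\<alpha> (Suc j))) \<le> (1/2) ^ j" for j
    proof -
      have "(1/2 :: real) ^ (j + 2) = (1/2) ^ j / 4" "(1/2 :: real) ^ (Suc j + 2) = (1/2) ^ j / 8"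
        by (simp_all add: power_add power2_eq_square)
      moreover have "(0 :: real) < (1/2) ^ j" by simp
      ultimately show ?thesis
        using \<alpha>[of j] \<alpha>[of "Suc j"] dist_triangle2[of "q (\<alpha> j)" "q (\<alpha> (Suc j))" x] by linarith
    qed
    then have "\<alpha> \<in> C" by (auto simp: C_def)
    have "(\<lambda>j. q (\<alpha> j)) \<longlonglongrightarrow> x"
    proof (rule metric_LIMSEQ_I)
      fix e :: real assume "e > 0"
      then obtain j where j: "2 * (1/2) ^ j < e" using small by auto
      have "dist (q (\<alpha> k)) x < e" if "k \<ge> j" for k
      proof -
        have "(1/2) ^ (k + 2) \<le> (1/2 :: real) ^ j" using that(1) by (intro power_decreasing) auto
        moreover have "(0 :: real) < (1/2) ^ j" by simp
        ultimately show ?thesis using \<alpha>[of k] j by linarith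
      qed
      then show "\<exists>no. \<forall>n\<ge>no. dist (q (\<alpha> n)) x < e" by blast
    qed
    then have "f \<alpha> = x" using conv[OF \<open>\<alpha> \<in> C\<close>] LIMSEQ_unique by blast
    then show "x \<in> f ` C" using \<open>\<alpha> \<in> C\<close> by blast
  qed simp
  ultimately show ?thesis unfolding analytic_set_def using \<open>closed C\<close> by blast
qed

lemma closed_imp_analytic_set:
  fixes S :: "'a::{complete_space, second_countable_topology} set"
  assumes "closed S"
  shows "analytic_set S"
proof -
  obtain C :: "(nat \<Rightarrow> nat) set" and f :: "(nat \<Rightarrow> nat) \<Rightarrow> 'a" where C: "closed C" "continuous_on C f" "UNIV = f ` C"
    using analytic_set_UNIV unfolding analytic_set_def by blast
  have "closed (C \<inter> f -` S)" by (intro continuous_closed_preimage C assms)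
  moreover have "continuous_on (C \<inter> f -` S) f" by (rule continuous_on_subset[OF C(2)]) auto
  moreover have "S = f ` (C \<inter> f -` S)"
  proof (intro equalityI subsetI)
    fix x assume "x \<in> S"
    moreover obtain \<alpha> where "\<alpha> \<in> C" "x = f \<alpha>" using C(3) by (metis UNIV_I imageE)
    ultimately show "x \<in> f ` (C \<inter> f -` S)" by blast
  qed auto
  ultimately show ?thesis unfolding analytic_set_def by blast
qed

lemma open_imp_analytic_set:
  fixes S :: "'a::{complete_space, second_countable_topology} set"
  assumes "open S"
  shows "analytic_set S"
proof (cases "S = UNIV")
  case True
  then show ?thesis by (simp add: analytic_set_UNIV)
next
  case False
  then have ne: "- S \<noteq> {}" by auto
  have S_eq: "S = (\<Union>n. {x. infdist x (- S) \<ge> inverse (real (Suc n))})"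
  proof (intro equalityI subsetI)
    fix x assume "x \<in> S"
    then have "infdist x (- S) > 0"
      using assms ne in_closed_iff_infdist_zero[of "- S" x] infdist_nonneg[of x "- S"] by fastforce
    then obtain n where "inverse (real (Suc n)) < infdist x (- S)" using reals_Archimedean by blast
    then show "x \<in> (\<Union>n. {x. infdist x (- S) \<ge> inverse (real (Suc n))})" by (auto intro: less_imp_le)
  next
    fix x assume "x \<in> (\<Union>n. {x. infdist x (- S) \<ge> inverse (real (Suc n))})"
    then obtain n where n: "infdist x (- S) \<ge> inverse (real (Suc n))" by auto
    have "inverse (real (Suc n)) > 0" by simp
    then have "infdist x (- S) > 0" using n by linarith
    then show "x \<in> S" by (metis ComplI infdist_zero less_irrefl)
  qed
  show ?thesis
    by (rule ssubst[OF S_eq, of analytic_set])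
      (intro analytic_set_UN closed_imp_analytic_set closed_Collect_le continuous_intros)
qed

text \<open>
  The sets that are analytic together with their complements form a \<open>\<sigma>\<close>-algebra.
\<close>

lemma borel_imp_analytic_set:
  fixes S :: "'a::{complete_space, second_countable_topology} set"
  assumes "S \<in> sets borel"
  shows "analytic_set S"
proof -
  have "S \<in> sigma_sets UNIV {S. open S}" using assms by (simp add: borel_def)
  then have "analytic_set S \<and> analytic_set (- S)"
  proof (induction rule: sigma_sets.induct)
    case (Basic a)
    then show ?case by (auto intro: open_imp_analytic_set closed_imp_analytic_set)
  next
    case Empty
    then show ?case by (auto intro: open_imp_analytic_set)
  next
    case (Compl a)
    then show ?case by (auto simp: Compl_eq_Diff_UNIV[symmetric])
  next
    case (Union a)
    then show ?case using analytic_set_UN[of a] analytic_set_INT[of "\<lambda>n. - a n"] by (auto simp: Compl_UN)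
  qed
  then show ?thesis by simp
qed

definition borel_separated :: "'a::topological_space set \<Rightarrow> 'a set \<Rightarrow> bool" where
  "borel_separated P Q \<longleftrightarrow> (\<exists>S \<in> sets borel. P \<subseteq> S \<and> S \<inter> Q = {})"

text \<open>
  Contrapositively: if two unions cannot be separated, some pair of pieces cannot. This is what
  drives the refinement of codes in Lusin's theorem.
\<close>

lemma borel_separated_UN_UN:
  fixes P Q :: "nat \<Rightarrow> 'a::topological_space set"
  assumes "\<And>a b. borel_separated (P a) (Q b)"
  shows "borel_separated (\<Union>a. P a) (\<Union>b. Q b)"
proof -
  have "\<forall>a b. \<exists>S. S \<in> sets borel \<and> P a \<subseteq> S \<and> S \<inter> Q b = {}"
    using assms by (simp add: borel_separated_def Bex_def)
  then obtain S where S: "\<And>a b. S a b \<in> sets borel" "\<And>a b. P a \<subseteq> S a b" "\<And>a b. S a b \<inter> Q b = {}"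
    by metis
  have "(\<Union>a. \<Inter>b. S a b) \<in> sets borel" using S(1) by auto
  moreover have "(\<Union>a. P a) \<subseteq> (\<Union>a. \<Inter>b. S a b)" using S(2) by blast
  moreover have "(\<Union>a. \<Inter>b. S a b) \<inter> (\<Union>b. Q b) = {}" using S(3) by blast
  ultimately show ?thesis unfolding borel_separated_def by blast
qed

definition cylinder :: "nat list \<Rightarrow> (nat \<Rightarrow> nat) set" where
  "cylinder s = {\<alpha>. \<forall>i<length s. \<alpha> i = s ! i}"

lemma cylinder_split: "cylinder s = (\<Union>a. cylinder (s @ [a]))"
proof (intro equalityI subsetI)
  fix \<alpha> assume "\<alpha> \<in> cylinder s"
  then have "\<alpha> \<in> cylinder (s @ [\<alpha> (length s)])" by (simp add: cylinder_def nth_append less_Suc_eq)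
  then show "\<alpha> \<in> (\<Union>a. cylinder (s @ [a]))" by blast
qed (auto simp: cylinder_def nth_append)

lemma cylinder_neighbourhood:
  assumes "open U" "\<alpha> \<in> U"
  shows "\<exists>n. cylinder (map \<alpha> [0..<n]) \<subseteq> U"
proof -
  obtain X where X: "\<alpha> \<in> (\<Pi>\<^sub>E i\<in>UNIV. X i)" "\<And>i. open (X i)" "finite {i. X i \<noteq> UNIV}" "(\<Pi>\<^sub>E i\<in>UNIV. X i) \<subseteq> U"
    using product_topology_open_contains_basis[of "\<lambda>i. euclidean" UNIV U \<alpha>] assms
    unfolding open_fun_def by auto
  obtain n where n: "\<And>i. X i \<noteq> UNIV \<Longrightarrow> i < n"
    using X(3) unfolding finite_nat_iff_bounded by blast
  have "cylinder (map \<alpha> [0..<n]) \<subseteq> (\<Pi>\<^sub>E i\<in>UNIV. X i)"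
  proof
    fix \<beta> assume \<beta>: "\<beta> \<in> cylinder (map \<alpha> [0..<n])"
    have "\<beta> i \<in> X i" for i
      using \<beta> n[of i] X(1) by (cases "X i = UNIV") (auto simp: cylinder_def PiE_iff)
    then show "\<beta> \<in> (\<Pi>\<^sub>E i\<in>UNIV. X i)" by auto
  qed
  then show ?thesis using X(4) by blast
qed

text \<open>
  If the sets could not be separated, one could extend a pair of finite codes step by step so that the
  corresponding pieces remain inseparable. The two limiting codes name distinct points, and disjoint
  neighbourhoods of these separate all sufficiently small pieces.
\<close>

theorem lusin_separation:
  fixes A B :: "'a::t2_space set"
  assumes "analytic_set A" "analytic_set B" "A \<inter> B = {}"
  shows "\<exists>S \<in> sets borel. A \<subseteq> S \<and> S \<inter> B = {}"
proof (rule ccontr)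
  assume "\<not> ?thesis"
  then have nsep: "\<not> borel_separated A B" by (simp add: borel_separated_def)
  obtain C :: "(nat \<Rightarrow> nat) set" and f where C: "closed C" "continuous_on C f" "A = f ` C"
    using assms(1) unfolding analytic_set_def by blast
  obtain D :: "(nat \<Rightarrow> nat) set" and g where D: "closed D" "continuous_on D g" "B = g ` D"
    using assms(2) unfolding analytic_set_def by blast
  define bad where "bad = (\<lambda>p. \<not> borel_separated (f ` (C \<inter> cylinder (fst p))) (g ` (D \<inter> cylinder (snd p))))"
  \<comment> \<open>An inseparable pair of codes has an inseparable pair of one-step extensions.\<close>
  have ext: "\<exists>a b. bad (s @ [a], t @ [b])" if "bad (s, t)" for s t
  proof (rule ccontr)
    assume "\<not> ?thesis"
    then have "borel_separated (\<Union>a. f ` (C \<inter> cylinder (s @ [a]))) (\<Union>b. g ` (D \<inter> cylinder (t @ [b])))"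
      by (intro borel_separated_UN_UN) (auto simp: bad_def)
    moreover have "(\<Union>a. f ` (C \<inter> cylinder (s @ [a]))) = f ` (C \<inter> cylinder s)"
      by (subst cylinder_split[of s]) blast
    moreover have "(\<Union>b. g ` (D \<inter> cylinder (t @ [b]))) = g ` (D \<inter> cylinder t)"
      by (subst cylinder_split[of t]) blast
    ultimately show False using that by (simp add: bad_def)
  qed
  have "\<exists>h. \<forall>n. (length (fst (h n)) = n \<and> length (snd (h n)) = n \<and> bad (h n)) \<and>
         (\<exists>a b. h (Suc n) = (fst (h n) @ [a], snd (h n) @ [b]))"
  proof (rule dependent_nat_choice)
    show "\<exists>x. length (fst x) = 0 \<and> length (snd x) = 0 \<and> bad x"
      using nsep C(3) D(3) by (intro exI[of _ "([], [])"]) (simp add: bad_def cylinder_def)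
  next
    fix x n assume x: "length (fst x) = n \<and> length (snd x) = n \<and> bad x"
    then obtain a b where "bad (fst x @ [a], snd x @ [b])" using ext[of "fst x" "snd x"] by auto
    with x show "\<exists>y. (length (fst y) = Suc n \<and> length (snd y) = Suc n \<and> bad y) \<and>
         (\<exists>a b. y = (fst x @ [a], snd x @ [b]))"
      by (intro exI[of _ "(fst x @ [a], snd x @ [b])"]) auto
  qed
  then obtain h where h: "\<And>n. length (fst (h n)) = n" "\<And>n. length (snd (h n)) = n" "\<And>n. bad (h n)"
     "\<And>n. \<exists>a b. h (Suc n) = (fst (h n) @ [a], snd (h n) @ [b])" by metis
  define \<alpha> where "\<alpha> = (\<lambda>i. fst (h (Suc i)) ! i)"
  define \<beta> where "\<beta> = (\<lambda>i. snd (h (Suc i)) ! i)"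
  have \<alpha>: "map \<alpha> [0..<n] = fst (h n)" and \<beta>: "map \<beta> [0..<n] = snd (h n)" for n
  proof (induction n)
    case (Suc n)
    obtain a b where ab: "h (Suc n) = (fst (h n) @ [a], snd (h n) @ [b])" using h(4) by blast
    { case 1 show ?case using Suc ab h(1)[of n] by (simp add: \<alpha>_def nth_append) }
    { case 2 show ?case using Suc ab h(2)[of n] by (simp add: \<beta>_def nth_append) }
  qed (use h(1)[of 0] h(2)[of 0] in auto)
  \<comment> \<open>Empty pieces are separable, so the limiting codes are limits of elements of the closed sets.\<close>
  have ne: "C \<inter> cylinder (map \<alpha> [0..<n]) \<noteq> {}" "D \<inter> cylinder (map \<beta> [0..<n]) \<noteq> {}" for n
    using h(3)[of n] by (auto simp: bad_def \<alpha> \<beta> borel_separated_def intro: bexI[of _ "{}"] bexI[of _ UNIV])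
  have "\<alpha> \<in> C"
  proof (rule ccontr)
    assume "\<alpha> \<notin> C"
    then obtain n where "cylinder (map \<alpha> [0..<n]) \<subseteq> - C"
      using cylinder_neighbourhood[of "- C" \<alpha>] C(1) by auto
    then show False using ne(1)[of n] by blast
  qed
  have "\<beta> \<in> D"
  proof (rule ccontr)
    assume "\<beta> \<notin> D"
    then obtain n where "cylinder (map \<beta> [0..<n]) \<subseteq> - D"
      using cylinder_neighbourhood[of "- D" \<beta>] D(1) by auto
    then show False using ne(2)[of n] by blast
  qed
  have neq: "f \<alpha> \<noteq> g \<beta>" using assms(3) C(3) D(3) \<open>\<alpha> \<in> C\<close> \<open>\<beta> \<in> D\<close> by blast
  then obtain U V where UV: "open U" "open V" "f \<alpha> \<in> U" "g \<beta> \<in> V" "U \<inter> V = {}"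
    using hausdorff[OF neq] by auto
  obtain U' where U': "open U'" "U' \<inter> C = f -` U \<inter> C"
    using C(2) UV(1) by (auto simp: continuous_on_open_invariant)
  obtain V' where V': "open V'" "V' \<inter> D = g -` V \<inter> D"
    using D(2) UV(2) by (auto simp: continuous_on_open_invariant)
  obtain n where n: "cylinder (map \<alpha> [0..<n]) \<subseteq> U'"
    using cylinder_neighbourhood[of U' \<alpha>] U' \<open>\<alpha> \<in> C\<close> UV by auto
  obtain m where m: "cylinder (map \<beta> [0..<m]) \<subseteq> V'"
    using cylinder_neighbourhood[of V' \<beta>] V' \<open>\<beta> \<in> D\<close> UV by auto
  define k where "k = max n m"
  have "cylinder (map \<alpha> [0..<k]) \<subseteq> cylinder (map \<alpha> [0..<n])" "cylinder (map \<beta> [0..<k]) \<subseteq> cylinder (map \<beta> [0..<m])"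
    by (auto simp: cylinder_def k_def)
  then have "f ` (C \<inter> cylinder (map \<alpha> [0..<k])) \<subseteq> U" "g ` (D \<inter> cylinder (map \<beta> [0..<k])) \<subseteq> V"
    using n m U'(2) V'(2) by blast+
  then have "borel_separated (f ` (C \<inter> cylinder (map \<alpha> [0..<k]))) (g ` (D \<inter> cylinder (map \<beta> [0..<k])))"
    unfolding borel_separated_def using UV by (intro bexI[of _ U]) auto
  then show False using h(3)[of k] by (simp add: bad_def \<alpha> \<beta>)
qed

section \<open>Borel projections along bounded finite sections\<close>

lemma analytic_set_Int:
  fixes A B :: "'a::t2_space set"
  assumes "analytic_set A" "analytic_set B"
  shows "analytic_set (A \<inter> B)"
proof -
  have "analytic_set (\<Inter>n. if n = (0 :: nat) then A else B)"
    using assms by (intro analytic_set_INT) auto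
  moreover have "(\<Inter>n. if n = (0 :: nat) then A else B) = A \<inter> B"
    by (auto split: if_splits) 
  ultimately show ?thesis by simp
qed

lemma analytic_set_INT_finite:
  fixes A :: "'i \<Rightarrow> 'a::{complete_space, second_countable_topology} set"
  assumes "finite I" "\<And>i. i \<in> I \<Longrightarrow> analytic_set (A i)"
  shows "analytic_set (\<Inter>i\<in>I. A i)"
  using assms
proof (induction I rule: finite_induct)
  case empty
  then show ?case by (simp add: analytic_set_UNIV)
next
  case (insert i I)
  then show ?case by (simp add: analytic_set_Int)
qed

lemma measurableI_count_space_countable:
  fixes f :: "'a \<Rightarrow> 'b::countable"
  assumes "\<And>a. f -` {a} \<inter> space M \<in> sets M"
  shows "f \<in> M \<rightarrow>\<^sub>M count_space UNIV"
  using assms by (subst measurable_count_space_eq_countable) auto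

text \<open>
  The label \<open>k m x\<close> records which of the first \<open>m\<close> basic open sets contain \<open>x\<close>; finitely many points
  are told apart as soon as \<open>m\<close> is large.
\<close>

lemma finite_separating_labels:
  "\<exists>k :: nat \<Rightarrow> 'a::{second_countable_topology, t1_space} \<Rightarrow> nat.
     (\<forall>m. k m \<in> borel \<rightarrow>\<^sub>M count_space UNIV) \<and> (\<forall>F. finite F \<longrightarrow> (\<exists>m. inj_on (k m) F))"
proof -
  obtain \<B> :: "'a set set" where \<B>: "countable \<B>" "topological_basis \<B>"
    using ex_countable_basis by blast
  have "\<B> \<noteq> {}"
  proof
    assume "\<B> = {}"
    then show False using \<B>(2) topological_basisE[of \<B> UNIV undefined] by auto
  qed
  define U where "U = from_nat_into \<B>"
  have ran: "range U = \<B>" unfolding U_def using \<B>(1) \<open>\<B> \<noteq> {}\<close> by simp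
  have U[measurable]: "U n \<in> sets borel" for n
    using topological_basis_open[OF \<B>(2), of "U n"] ran by (intro borel_open) blast
  have sep: "\<exists>n. x \<in> U n \<and> y \<notin> U n" if neq: "x \<noteq> y" for x y
  proof -
    obtain V where V: "open V" "x \<in> V" "y \<notin> V" using t1_space[OF neq] by blast
    obtain B where "B \<in> \<B>" "x \<in> B" "B \<subseteq> V" using topological_basisE[OF \<B>(2) V(1,2)] by blast
    then show ?thesis using ran V(3) by blast
  qed
  define k where "k = (\<lambda>m x. set_encode {n. n < m \<and> x \<in> U n})"
  have fin: "finite {n. n < m \<and> x \<in> U n}" for m :: nat and x by auto
  have "k m \<in> borel \<rightarrow>\<^sub>M count_space UNIV" for m
  proof (rule measurableI_count_space_countable)
    show "k m -` {a} \<inter> space borel \<in> sets borel" for a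
    proof -
      have "k m x = a \<longleftrightarrow> (\<forall>n. (n < m \<and> x \<in> U n) \<longleftrightarrow> n \<in> set_decode a)" for x
      proof -
        have "k m x = a \<longleftrightarrow> {n. n < m \<and> x \<in> U n} = set_decode a"
          unfolding k_def using fin[of m x] by (metis set_decode_inverse set_encode_inverse)
        then show ?thesis by blast
      qed
      then have "k m -` {a} \<inter> space borel
          = {x \<in> space borel. \<forall>n. (n < m \<and> x \<in> U n) \<longleftrightarrow> n \<in> set_decode a}" by auto
      also have "\<dots> \<in> sets borel" by measurable
      finally show ?thesis .
    qed
  qed
  moreover have "\<exists>m. inj_on (k m) F" if "finite F" for F
  proof -
    have "\<forall>p. \<exists>n. fst p \<noteq> snd p \<longrightarrow> fst p \<in> U n \<and> snd p \<notin> U n" using sep by auto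
    then obtain w where w: "\<And>p. fst p \<noteq> snd p \<Longrightarrow> fst p \<in> U (w p) \<and> snd p \<notin> U (w p)" by metis
    have "finite (w ` (F \<times> F))" using that by auto
    then obtain m where m: "w ` (F \<times> F) \<subseteq> {..<m}" unfolding finite_nat_iff_bounded by blast
    have "inj_on (k m) F"
    proof (rule inj_onI, rule ccontr)
      fix x y assume xy: "x \<in> F" "y \<in> F" "k m x = k m y" "x \<noteq> y"
      have "{n. n < m \<and> x \<in> U n} = {n. n < m \<and> y \<in> U n}"
        using xy(3) fin unfolding k_def by (metis set_encode_inverse)
      moreover have "w (x, y) < m" using m xy by auto
      ultimately show False using w[of "(x, y)"] xy(4) by auto
    qed
    then show ?thesis ..
  qed
  ultimately show ?thesis by (intro exI[of _ k]) blast
qed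

text \<open>
  For \<open>x \<in> Q\<close> with section \<open>{y}\<close>, the conditions \<open>y n < q\<close> and \<open>q \<le> y n\<close> define disjoint analytic sets
  of points \<open>x\<close>. Borel sets separating them for all rational \<open>q\<close> recover the real number \<open>y n\<close> as an infimum.
\<close>

lemma borel_uniformization_of_unique_section:
  fixes F :: "('b::{complete_space, second_countable_topology} \<times> (nat \<Rightarrow> real)) set"
  assumes Q: "analytic_set Q" and F: "F \<in> sets borel"
    and unique: "\<And>x. x \<in> Q \<Longrightarrow> \<exists>!y. (x, y) \<in> F"
  shows "\<exists>\<psi> \<in> borel_measurable borel. \<forall>x\<in>Q. (x, \<psi> x) \<in> F"
proof -
  have coord: "continuous_on UNIV (\<lambda>p :: 'b \<times> (nat \<Rightarrow> real). snd p n)" for n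
    by (rule continuous_on_compose2[OF continuous_on_product_coordinates continuous_on_snd[OF continuous_on_id]]) auto
  have an: "analytic_set (Q \<inter> fst ` (F \<inter> H))" if "H \<in> sets borel" for H
    by (intro analytic_set_Int Q analytic_set_image borel_imp_analytic_set continuous_on_fst continuous_on_id)
      (use F that in auto)
  have "\<exists>S. S \<in> sets borel \<and> Q \<inter> fst ` (F \<inter> {p. snd p n < real_of_rat q}) \<subseteq> S \<and>
       S \<inter> (Q \<inter> fst ` (F \<inter> {p. real_of_rat q \<le> snd p n})) = {}" for n q
  proof -
    have "\<exists>S \<in> sets borel. Q \<inter> fst ` (F \<inter> {p. snd p n < real_of_rat q}) \<subseteq> S \<and>
       S \<inter> (Q \<inter> fst ` (F \<inter> {p. real_of_rat q \<le> snd p n})) = {}"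
    proof (intro lusin_separation an)
      show "{p :: 'b \<times> (nat \<Rightarrow> real). snd p n < real_of_rat q} \<in> sets borel"
        by (intro borel_open open_Collect_less coord continuous_on_const)
      show "{p :: 'b \<times> (nat \<Rightarrow> real). real_of_rat q \<le> snd p n} \<in> sets borel"
        by (intro borel_closed closed_Collect_le coord continuous_on_const)
      show "Q \<inter> fst ` (F \<inter> {p. snd p n < real_of_rat q}) \<inter> (Q \<inter> fst ` (F \<inter> {p. real_of_rat q \<le> snd p n})) = {}"
        using unique by fastforce
    qed
    then show ?thesis by blast
  qed
  then obtain S where S[measurable]: "\<And>n q. S n q \<in> sets borel"
    and S1: "\<And>n q. Q \<inter> fst ` (F \<inter> {p. snd p n < real_of_rat q}) \<subseteq> S n q"
    and S2: "\<And>n q. S n q \<inter> (Q \<inter> fst ` (F \<inter> {p. real_of_rat q \<le> snd p n})) = {}"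
    by metis
  \<comment> \<open>The extended reals keep the infimum total where the separating sets say nothing about a section.\<close>
  define \<psi> where "\<psi> = (\<lambda>x n. real_of_ereal (INF q. if x \<in> S n q then ereal (real_of_rat q) else \<infinity>))"
  have "\<psi> \<in> borel_measurable borel"
    unfolding \<psi>_def by (rule measurable_coordinatewise_then_product) measurable
  moreover have "(x, \<psi> x) \<in> F" if x: "x \<in> Q" for x
  proof -
    obtain y where y: "(x, y) \<in> F" using unique[OF x] by blast
    have "(INF q. if x \<in> S n q then ereal (real_of_rat q) else \<infinity>) = ereal (y n)" for n
    proof -
      have iff: "x \<in> S n q \<longleftrightarrow> y n < real_of_rat q" for q
      proof
        assume "x \<in> S n q"
        show "y n < real_of_rat q"
        proof (rule ccontr)
          assume "\<not> ?thesis"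
          then have "x \<in> fst ` (F \<inter> {p. real_of_rat q \<le> snd p n})"
            using y by (intro image_eqI[of _ _ "(x, y)"]) auto
          then show False using S2[of n q] x \<open>x \<in> S n q\<close> by blast
        qed
      next
        assume "y n < real_of_rat q"
        then have "x \<in> fst ` (F \<inter> {p. snd p n < real_of_rat q})"
          using y by (intro image_eqI[of _ _ "(x, y)"]) auto
        then show "x \<in> S n q" using S1[of n q] x by blast
      qed
      show ?thesis
      proof (rule INF_eqI)
        fix z assume z: "\<And>q. q \<in> UNIV \<Longrightarrow> z \<le> (if x \<in> S n q then ereal (real_of_rat q) else \<infinity>)"
        show "z \<le> ereal (y n)"
        proof (rule ccontr)
          assume "\<not> ?thesis"
          then have "ereal (y n) < z" by simp
          then obtain t where t: "ereal (y n) < ereal t" "ereal t < z" using ereal_dense2 by blast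
          then obtain q where q: "y n < real_of_rat q" "real_of_rat q < t" using of_rat_dense[of "y n" t] by auto
          have "z \<le> ereal (real_of_rat q)" using z[of q] iff[of q] q(1) by auto
          also have "\<dots> < ereal t" using q(2) by simp
          finally show False using t(2) by simp
        qed
      qed (auto simp: iff)
    qed
    then have "\<psi> x = y" by (auto simp: \<psi>_def)
    then show ?thesis using y by simp
  qed
  ultimately show ?thesis by blast
qed

text \<open>
  Induction on the bound. If a label function takes at least \<open>D + 1\<close> prescribed values on a section of
  size at most \<open>D + 1\<close>, it is injective there, and each point of the section is the unique one with its label.
  Uniformization then turns the analytic set of all such \<open>x\<close> into a Borel set. These sets cover the points
  whose section has exactly \<open>D + 1\<close> elements; the remaining sections are smaller.
\<close>

theorem borel_projection_bounded_sections:
  fixes E :: "('b::{complete_space, second_countable_topology} \<times> (nat \<Rightarrow> real)) set"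
  assumes "E \<in> sets borel" and "\<And>x. finite (E `` {x}) \<and> card (E `` {x}) \<le> D"
  shows "fst ` E \<in> sets borel"
  using assms
proof (induction D arbitrary: E)
  case 0
  have "E = {}"
  proof (rule ccontr)
    assume "E \<noteq> {}"
    then obtain x y where "(x, y) \<in> E" by auto
    then show False using "0.prems"(2)[of x] by auto
  qed
  then show ?case by simp
next
  case (Suc D)
  note E = Suc.prems(1) and card = Suc.prems(2)
  obtain k :: "nat \<Rightarrow> (nat \<Rightarrow> real) \<Rightarrow> nat" where k[measurable]: "\<And>m. k m \<in> borel \<rightarrow>\<^sub>M count_space UNIV"
    and kinj: "\<And>F. finite F \<Longrightarrow> \<exists>m. inj_on (k m) F"
    using finite_separating_labels by metis
  define G where "G = (\<lambda>m i. E \<inter> {p. k m (snd p) = i})"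
  have G: "G m i \<in> sets borel" for m i
  proof -
    have "{p \<in> space (borel :: ('b \<times> (nat \<Rightarrow> real)) measure). k m (snd p) = i} \<in> sets borel"
      unfolding borel_prod[symmetric] by measurable
    then show ?thesis using E by (auto simp: G_def)
  qed
  define Q where "Q = (\<lambda>m I. {x. I \<subseteq> k m ` (E `` {x})})"
  have Q: "Q m I \<in> sets borel" if I: "finite I" "card I = Suc D" for m I
  proof -
    have "Q m I = (\<Inter>i\<in>I. fst ` G m i)"
      by (force simp: Q_def G_def)
    moreover have "analytic_set (\<Inter>i\<in>I. fst ` G m i)"
      by (intro analytic_set_INT_finite I(1) analytic_set_image borel_imp_analytic_set G continuous_on_fst continuous_on_id)
    ultimately have an: "analytic_set (Q m I)" by (rule ssubst)
    have uni: "\<exists>!y. (x, y) \<in> G m i" if x: "x \<in> Q m I" and i: "i \<in> I" for x i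
    proof -
      have fin: "finite (E `` {x})" "card (E `` {x}) \<le> Suc D" using card[of x] by auto
      have "card I \<le> card (k m ` (E `` {x}))"
        using x fin by (intro card_mono) (auto simp: Q_def)
      then have "card (k m ` (E `` {x})) = card (E `` {x})"
        using I(2) fin card_image_le[OF fin(1), of "k m"] by linarith
      then have "inj_on (k m) (E `` {x})" using fin(1) eq_card_imp_inj_on by blast
      moreover obtain y where "(x, y) \<in> E" "k m y = i" using x i by (auto simp: Q_def)
      ultimately show ?thesis by (intro ex1I[of _ y]) (auto simp: G_def inj_on_def)
    qed
    have "\<forall>i\<in>I. \<exists>\<psi> \<in> borel_measurable borel. \<forall>x\<in>Q m I. (x, \<psi> x) \<in> G m i"
      using borel_uniformization_of_unique_section[OF an G] uni by blast
    then obtain \<psi> where \<psi>: "\<And>i. i \<in> I \<Longrightarrow> \<psi> i \<in> borel_measurable borel"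
      "\<And>i x. i \<in> I \<Longrightarrow> x \<in> Q m I \<Longrightarrow> (x, \<psi> i x) \<in> G m i" by metis
    have "I \<noteq> {}" using I by auto
    have eq: "Q m I = (\<Inter>i\<in>I. (\<lambda>x. (x, \<psi> i x)) -` G m i)"
    proof (intro equalityI subsetI)
      fix x assume "x \<in> (\<Inter>i\<in>I. (\<lambda>x. (x, \<psi> i x)) -` G m i)"
      then show "x \<in> Q m I" by (force simp: Q_def G_def)
    qed (use \<psi>(2) in auto)
    have "(\<lambda>x. (x, \<psi> i x)) -` G m i \<in> sets borel" if "i \<in> I" for i
    proof -
      have "(\<lambda>x. (x, \<psi> i x)) \<in> borel_measurable borel" using \<psi>(1)[OF that] by measurable
      from measurable_sets[OF this G] show ?thesis by simp
    qed
    then show ?thesis unfolding eq using I(1) \<open>I \<noteq> {}\<close> by (intro sets.finite_INT) auto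
  qed
  \<comment> \<open>The points whose section has exactly D + 1 elements.\<close>
  define W where "W = (\<Union>m. \<Union>I\<in>{I. finite I \<and> card I = Suc D}. Q m I)"
  have W: "W \<in> sets borel"
    unfolding W_def
  proof (intro sets.countable_UN image_subsetI)
    fix m
    have "countable {I :: nat set. finite I \<and> card I = Suc D}"
      by (rule countable_subset[OF _ countable_Collect_finite]) auto
    then show "(\<Union>I\<in>{I. finite I \<and> card I = Suc D}. Q m I) \<in> sets borel"
      by (rule sets.countable_UN') (use Q in auto)
  qed
  have "E \<inter> (- W) \<times> UNIV \<in> sets borel"
  proof -
    have "(- W) \<times> (UNIV :: (nat \<Rightarrow> real) set) \<in> sets (borel \<Otimes>\<^sub>M borel)"
      using W by (intro pair_measureI) (auto intro: borel_comp)
    then show ?thesis unfolding borel_prod by (rule sets.Int[OF E])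
  qed
  then have "fst ` (E \<inter> (- W) \<times> UNIV) \<in> sets borel"
  proof (rule Suc.IH)
    fix x
    have sec: "(E \<inter> (- W) \<times> UNIV) `` {x} = (if x \<in> W then {} else E `` {x})" by auto
    have "card (E `` {x}) \<noteq> Suc D" if "x \<notin> W"
    proof
      assume *: "card (E `` {x}) = Suc D"
      obtain m where m: "inj_on (k m) (E `` {x})" using kinj card[of x] by blast
      have "x \<in> Q m (k m ` (E `` {x}))" by (auto simp: Q_def)
      moreover have "finite (k m ` (E `` {x}))" "card (k m ` (E `` {x})) = Suc D"
        using card[of x] * card_image[OF m] by auto
      ultimately have "x \<in> W" unfolding W_def by blast
      then show False using that by simp
    qed
    then show "finite ((E \<inter> (- W) \<times> UNIV) `` {x}) \<and> card ((E \<inter> (- W) \<times> UNIV) `` {x}) \<le> D"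
      using card[of x] unfolding sec by (cases "x \<in> W") auto
  qed
  moreover have "fst ` E = W \<union> fst ` (E \<inter> (- W) \<times> UNIV)"
  proof -
    have "W \<subseteq> fst ` E"
    proof
      fix x assume "x \<in> W"
      then obtain m I where "card I = Suc D" "I \<subseteq> k m ` (E `` {x})" by (auto simp: W_def Q_def)
      then have "E `` {x} \<noteq> {}" by (metis Zero_not_Suc card.empty image_empty subset_empty)
      then show "x \<in> fst ` E" by force
    qed
    then show ?thesis by force
  qed
  ultimately show ?case using W by auto
qed

lemma sigma_sets_image_inj_on:
  assumes inj: "inj_on f \<Omega>" and \<Omega>: "f ` \<Omega> \<in> sets N" and G: "G \<subseteq> Pow \<Omega>"
    and gen: "\<And>g. g \<in> G \<Longrightarrow> f ` g \<in> sets N" and A: "A \<in> sigma_sets \<Omega> G"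
  shows "f ` A \<in> sets N"
  using A
proof (induction rule: sigma_sets.induct)
  case (Compl a)
  have "a \<subseteq> \<Omega>" using sigma_sets_into_sp[OF G Compl.hyps] .
  then have "f ` (\<Omega> - a) = f ` \<Omega> - f ` a" using inj by (simp add: inj_on_image_set_diff)
  then show ?case using Compl.IH \<Omega> by auto
qed (auto simp: gen image_UN)

text \<open>
  The embedding sends \<open>x\<close> to its distances from a dense sequence \<open>q\<close>. A sequence \<open>z\<close> is in the image exactly
  when it is compatible with the triangle inequality and has arbitrarily small entries: the \<open>q n\<close>
  with small \<open>z n\<close> then form a Cauchy sequence. These are countably many Borel conditions.
\<close>

lemma standard_borel_embedding:
  assumes "standard_borel M" "space M \<noteq> {}"
  shows "\<exists>c :: 'a \<Rightarrow> nat \<Rightarrow> real. c \<in> borel_measurable M \<and> inj_on c (space M) \<and> (\<forall>S\<in>sets M. c ` S \<in> sets borel)"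
proof -
  obtain T where T: "completely_metrizable_space T" "second_countable T" "space M = topspace T"
      "sets M = sigma_sets (topspace T) {U. openin T U}"
    using assms(1) unfolding standard_borel_def by blast
  obtain X d where Xd: "Metric_space X d" "Metric_space.mcomplete X d" "T = Metric_space.mtopology X d"
    using T(1) unfolding completely_metrizable_space_def by blast
  interpret Metric_space X d by (rule Xd(1))
  have sp: "space M = X" using T(3) Xd(3) by simp
  obtain D where D: "countable D" "D \<subseteq> topspace T" "T closure_of D = topspace T"
    using second_countable_imp_separable_space[OF T(2)] unfolding separable_space_def by blast
  have "D \<noteq> {}" using D(3) assms(2) T(3) by (metis closure_of_empty)
  define q where "q = from_nat_into D"
  have ran: "range q = D" unfolding q_def using D(1) \<open>D \<noteq> {}\<close> by simp
  have qX: "q n \<in> X" for n using ran D(2) Xd(3) by auto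
  have dense: "\<exists>n. d (q n) x < e" if x: "x \<in> X" and e: "e > 0" for x e
  proof -
    have "x \<in> mtopology closure_of D" using x D(3) Xd(3) by simp
    then obtain y where "y \<in> D" "y \<in> mball x e" using e by (auto simp: metric_closure_of)
    then show ?thesis using ran by (auto simp: commute)
  qed
  have open_sets: "U \<in> sets M" if "openin mtopology U" for U
    using that T(4) Xd(3) by (auto intro: sigma_sets.Basic)
  define c where "c = (\<lambda>x n. d (q n) x)"
  have c: "c \<in> borel_measurable M"
    unfolding c_def
  proof (rule measurable_coordinatewise_then_product, rule borel_measurableI_less)
    fix n a
    have "{x \<in> space M. d (q n) x < a} = mball (q n) a" unfolding sp using qX by (auto simp: in_mball)
    then show "{x \<in> space M. d (q n) x < a} \<in> sets M" using open_sets by simp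
  qed
  have inj: "inj_on c X"
  proof (rule inj_onI, rule ccontr)
    fix x y assume xy: "x \<in> X" "y \<in> X" "c x = c y" "x \<noteq> y"
    then have "d x y > 0" using zero nonneg[of x y] by (metis less_eq_real_def)
    then obtain n where n: "d (q n) x < d x y / 2" using dense[of x "d x y / 2"] xy by auto
    moreover have "d (q n) y = d (q n) x" using xy(3) unfolding c_def by metis
    ultimately show False using triangle[of x "q n" y] xy qX[of n] by (simp add: commute)
  qed
  have coord[measurable]: "(\<lambda>z :: nat \<Rightarrow> real. z n) \<in> borel_measurable borel" for n
    by (rule borel_measurable_continuous_onI[OF continuous_on_product_coordinates])
  have img: "c ` X = {z \<in> space borel. (\<forall>n m. \<bar>z n - z m\<bar> \<le> d (q n) (q m) \<and> d (q n) (q m) \<le> z n + z m) \<and>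
       (\<forall>j. \<exists>n. z n < inverse (real (Suc j)))}" (is "_ = ?Y")
  proof (intro equalityI subsetI)
    fix z assume "z \<in> c ` X"
    then obtain x where x: "x \<in> X" "z = c x" by blast
    have "\<bar>z n - z m\<bar> \<le> d (q n) (q m) \<and> d (q n) (q m) \<le> z n + z m" for n m
      using triangle[OF qX[of n] qX[of m] x(1)] triangle[OF qX[of m] qX[of n] x(1)]
        triangle[OF qX[of n] x(1) qX[of m]] unfolding x(2) c_def
      by (simp add: commute)
    moreover have "\<exists>n. z n < inverse (real (Suc j))" for j
      using dense[OF x(1), of "inverse (real (Suc j))"] by (auto simp: x(2) c_def)
    ultimately show "z \<in> ?Y" by auto
  next
    fix z assume "z \<in> ?Y"
    then have z1: "\<And>n m. \<bar>z n - z m\<bar> \<le> d (q n) (q m)" and z2: "\<And>n m. d (q n) (q m) \<le> z n + z m"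
      and z3: "\<And>j. \<exists>n. z n < inverse (real (Suc j))" by auto
    from z3 obtain \<nu> where \<nu>: "\<And>j. z (\<nu> j) < inverse (real (Suc j))" by metis
    have z0: "0 \<le> z n" for n
      using z2[of n n] nonneg[of "q n" "q n"] by linarith
    have lim0: "(\<lambda>j. z (\<nu> j)) \<longlonglongrightarrow> 0"
    proof (rule tendsto_sandwich[OF _ _ tendsto_const LIMSEQ_inverse_real_of_nat])
      show "\<forall>\<^sub>F j in sequentially. 0 \<le> z (\<nu> j)" using z0 by simp
      show "\<forall>\<^sub>F j in sequentially. z (\<nu> j) \<le> inverse (real (Suc j))" using less_imp_le[OF \<nu>] by (intro always_eventually allI)
    qed
    have "MCauchy (\<lambda>j. q (\<nu> j))"
      unfolding MCauchy_def
    proof (intro conjI allI impI)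
      fix e :: real assume "e > 0"
      then obtain N where N: "\<And>j. j \<ge> N \<Longrightarrow> z (\<nu> j) < e / 2"
        using order_tendstoD(2)[OF lim0, of "e / 2"] unfolding eventually_sequentially by auto
      show "\<exists>N. \<forall>n n'. N \<le> n \<longrightarrow> N \<le> n' \<longrightarrow> d (q (\<nu> n)) (q (\<nu> n')) < e"
      proof (intro exI[of _ N] allI impI)
        fix n n' assume "N \<le> n" "N \<le> n'"
        then show "d (q (\<nu> n)) (q (\<nu> n')) < e" using N[of n] N[of n'] z2[of "\<nu> n" "\<nu> n'"] by linarith
      qed
    qed (use qX in auto)
    then obtain x where x: "limitin mtopology (\<lambda>j. q (\<nu> j)) x sequentially"
      using Xd(2) unfolding mcomplete_def by blast
    then have xX: "x \<in> X" and dlim: "(\<lambda>j. d (q (\<nu> j)) x) \<longlonglongrightarrow> 0"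
      by (auto simp: limitin_metric_dist_null)
    have "z n = d (q n) x" for n
    proof (rule antisym[OF field_le_epsilon field_le_epsilon])
      fix e :: real assume "e > 0"
      then have "\<forall>\<^sub>F j in sequentially. z (\<nu> j) < e / 2 \<and> d (q (\<nu> j)) x < e / 2"
        using order_tendstoD(2)[OF lim0, of "e / 2"] order_tendstoD(2)[OF dlim, of "e / 2"]
        by (auto intro: eventually_conj)
      then obtain j where j: "z (\<nu> j) < e / 2" "d (q (\<nu> j)) x < e / 2" 
        using eventually_happens'[OF sequentially_bot] by blast
      show "z n \<le> d (q n) x + e"
        using j z1[of n "\<nu> j"] triangle[OF qX[of n] xX qX[of "\<nu> j"]] by (simp add: commute abs_le_iff)
      show "d (q n) x \<le> z n + e"
        using j z2[of n "\<nu> j"] triangle[OF qX[of n] qX[of "\<nu> j"] xX] by (simp add: commute)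
    qed
    then have "z = c x" by (auto simp: c_def)
    then show "z \<in> c ` X" using xX by (rule image_eqI)
  qed
  have Y: "c ` X \<in> sets borel" unfolding img by measurable
  have "c ` S \<in> sets borel" if "S \<in> sets M" for S
  proof (rule sigma_sets_image_inj_on[OF inj Y])
    show "S \<in> sigma_sets X {U. openin T U}" using that T(4) Xd(3) by simp
    show "{U. openin T U} \<subseteq> Pow X" using Xd(3) openin_subset by fastforce
    fix U assume "U \<in> {U. openin T U}"
    then have U: "openin mtopology U" using Xd(3) by simp
    have "c ` U = c ` X \<inter> (\<Union>(n, r) \<in> {(n, r :: rat). mball (q n) (of_rat r) \<subseteq> U}. {z \<in> space borel. z n < of_rat r})"
    proof (intro equalityI subsetI)
      fix z assume "z \<in> c ` U"
      then obtain x where x: "x \<in> U" "z = c x" by blast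
      have xX: "x \<in> X" using U x(1) openin_subset by fastforce
      obtain e where e: "e > 0" "mball x e \<subseteq> U" using U x(1) unfolding openin_mtopology by blast
      obtain n where n: "d (q n) x < e / 2" using dense[OF xX, of "e / 2"] e(1) by auto
      obtain r where r: "d (q n) x < of_rat r" "of_rat r < e / 2" using of_rat_dense[OF n] by auto
      have "mball (q n) (of_rat r) \<subseteq> mball x e"
      proof
        fix y assume y: "y \<in> mball (q n) (of_rat r)"
        then show "y \<in> mball x e" using r n triangle[OF xX qX[of n], of y] xX by (auto simp: in_mball commute)
      qed
      then have "mball (q n) (of_rat r) \<subseteq> U" using e(2) by blast
      then show "z \<in> c ` X \<inter> (\<Union>(n, r) \<in> {(n, r :: rat). mball (q n) (of_rat r) \<subseteq> U}. {z \<in> space borel. z n < of_rat r})"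
        using x xX r(1) by (auto simp: c_def)
    next
      fix z assume "z \<in> c ` X \<inter> (\<Union>(n, r) \<in> {(n, r :: rat). mball (q n) (of_rat r) \<subseteq> U}. {z \<in> space borel. z n < of_rat r})"
      then obtain x n r where x: "x \<in> X" "z = c x" "mball (q n) (of_rat r) \<subseteq> U" "z n < of_rat r" by auto
      then have "x \<in> mball (q n) (of_rat r)" using qX by (auto simp: in_mball c_def)
      then show "z \<in> c ` U" using x by blast
    qed
    also have "\<dots> \<in> sets borel"
      by (intro sets.Int Y sets.countable_UN') (auto split: prod.splits)
    finally show "c ` U \<in> sets borel" .
  qed
  then show ?thesis using c inj sp by blast
qed

text \<open>
  The embedding of the space carries \<open>E\<close> to a Borel relation between sequences, with sections of the same size.
\<close>

theorem measurable_projection_bounded_sections: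
  assumes sb: "standard_borel M" and E: "E \<in> sets (M \<Otimes>\<^sub>M M)"
    and card: "\<And>x. x \<in> space M \<Longrightarrow> finite (E `` {x}) \<and> card (E `` {x}) \<le> D"
  shows "Domain E \<in> sets M"
proof (cases "space M = {}")
  case True
  have "Domain E \<subseteq> space M" using sets.sets_into_space[OF E] by (auto simp: space_pair_measure)
  then show ?thesis using True by auto
next
  case False
  obtain c :: "'a \<Rightarrow> nat \<Rightarrow> real" where c: "c \<in> borel_measurable M" "inj_on c (space M)" "\<And>S. S \<in> sets M \<Longrightarrow> c ` S \<in> sets borel"
    using standard_borel_embedding[OF sb False] by blast
  have EX: "E \<subseteq> space M \<times> space M" using sets.sets_into_space[OF E] by (auto simp: space_pair_measure)
  have "map_prod c c ` E \<in> sets (borel \<Otimes>\<^sub>M borel)"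
  proof (rule sigma_sets_image_inj_on)
    show "E \<in> sigma_sets (space M \<times> space M) {a \<times> b |a b. a \<in> sets M \<and> b \<in> sets M}"
      using E by (simp add: sets_pair_measure)
    show "inj_on (map_prod c c) (space M \<times> space M)" using c(2) by (intro map_prod_inj_on)
    have img: "map_prod c c ` (a \<times> b) \<in> sets (borel \<Otimes>\<^sub>M borel)" if "a \<in> sets M" "b \<in> sets M" for a b
      using c(3)[OF that(1)] c(3)[OF that(2)] by (simp add: map_prod_image)
    show "map_prod c c ` (space M \<times> space M) \<in> sets (borel \<Otimes>\<^sub>M borel)" by (intro img) auto
    show "map_prod c c ` g \<in> sets (borel \<Otimes>\<^sub>M borel)" if "g \<in> {a \<times> b |a b. a \<in> sets M \<and> b \<in> sets M}" for g
      using that img by auto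
    show "{a \<times> b |a b. a \<in> sets M \<and> b \<in> sets M} \<subseteq> Pow (space M \<times> space M)"
      using sets.sets_into_space by blast
  qed
  then have "map_prod c c ` E \<in> sets borel" unfolding borel_prod .
  then have "fst ` (map_prod c c ` E) \<in> sets borel"
  proof (rule borel_projection_bounded_sections)
    fix z
    show "finite ((map_prod c c ` E) `` {z}) \<and> card ((map_prod c c ` E) `` {z}) \<le> D"
    proof (cases "z \<in> c ` space M")
      case True
      then obtain x where x: "x \<in> space M" "z = c x" by blast
      have "(map_prod c c ` E) `` {z} \<subseteq> c ` (E `` {x})"
      proof
        fix w assume "w \<in> (map_prod c c ` E) `` {z}"
        then obtain u v where uv: "(u, v) \<in> E" "c u = z" "c v = w" by auto
        then have "u = x" using c(2) x EX by (auto simp: inj_on_def)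
        then show "w \<in> c ` (E `` {x})" using uv by blast
      qed
      moreover have "finite (c ` (E `` {x}))" "card (c ` (E `` {x})) \<le> D"
        using card[OF x(1)] card_image_le[of "E `` {x}" c] by auto
      ultimately show ?thesis by (meson card_mono finite_subset le_trans)
    next
      case False
      then have "(map_prod c c ` E) `` {z} = {}" using EX by auto
      then show ?thesis by simp
    qed
  qed
  then have "c -` (fst ` (map_prod c c ` E)) \<inter> space M \<in> sets M" by (rule measurable_sets[OF c(1)])
  moreover have "c -` (fst ` (map_prod c c ` E)) \<inter> space M = Domain E"
  proof (intro equalityI subsetI)
    fix x assume "x \<in> c -` (fst ` (map_prod c c ` E)) \<inter> space M"
    then obtain u v where uv: "(u, v) \<in> E" "c x = c u" "x \<in> space M" by auto
    then have "x = u" using EX c(2) by (auto dest: inj_onD)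
    then show "x \<in> Domain E" using uv by auto
  next
    fix x assume "x \<in> Domain E"
    then obtain v where "(x, v) \<in> E" by auto
    then show "x \<in> c -` (fst ` (map_prod c c ` E)) \<inter> space M" using EX by (force simp: image_image)
  qed
  ultimately show ?thesis by simp
qed

section \<open>The resolvent of the Markov operator on a locally finite graph\<close>

lemma markov_op_add: "markov_op E (\<lambda>u. f u + g u) = (\<lambda>u. markov_op E f u + markov_op E g u)"
  by (simp add: fun_eq_iff markov_op_def sum.distrib add_divide_distrib)

lemma markov_op_diff: "markov_op E (\<lambda>u. f u - g u) = (\<lambda>u. markov_op E f u - markov_op E g u)"
  by (simp add: fun_eq_iff markov_op_def sum_subtractf diff_divide_distrib)

lemma markov_op_cmult: "markov_op E (\<lambda>u. a * f u) = (\<lambda>u. a * markov_op E f u)"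
  by (simp add: fun_eq_iff markov_op_def sum_distrib_left[symmetric])

text \<open>
  The operator \<open>c I - \<M>\<close>, whose invertibility defines the spectrum.
\<close>

definition resolvent_op :: "('a \<times> 'a) set \<Rightarrow> complex \<Rightarrow> ('a \<Rightarrow> complex) \<Rightarrow> 'a \<Rightarrow> complex" where
  "resolvent_op E c f u = c * f u - markov_op E f u"

lemma resolvent_op_add: "resolvent_op E c (\<lambda>u. f u + g u) = (\<lambda>u. resolvent_op E c f u + resolvent_op E c g u)"
  by (simp add: resolvent_op_def markov_op_add fun_eq_iff algebra_simps)

lemma resolvent_op_diff: "resolvent_op E c (\<lambda>u. f u - g u) = (\<lambda>u. resolvent_op E c f u - resolvent_op E c g u)"
  by (simp add: resolvent_op_def markov_op_diff fun_eq_iff algebra_simps)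

lemma resolvent_op_cmult: "resolvent_op E c (\<lambda>u. a * f u) = (\<lambda>u. a * resolvent_op E c f u)"
  by (simp add: resolvent_op_def markov_op_cmult fun_eq_iff algebra_simps)

text \<open>
  Both operators are polynomials in the Markov operator.
\<close>

lemma resolvent_op_commute: "resolvent_op E c (resolvent_op E d f) = resolvent_op E d (resolvent_op E c f)"
proof -
  have eq: "resolvent_op E c (resolvent_op E d f) u = c * (d * f u) - c * markov_op E f u
         - (d * markov_op E f u - markov_op E (markov_op E f) u)" for c d u
  proof -
    have "resolvent_op E d f = (\<lambda>u. d * f u - markov_op E f u)"
      by (simp add: fun_eq_iff resolvent_op_def)
    then show ?thesis
      by (simp add: resolvent_op_def[of E c] markov_op_diff markov_op_cmult algebra_simps)
  qed
  show ?thesis by (rule ext) (simp add: eq algebra_simps)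
qed

locale locally_finite_graph =
  fixes V :: "'a set" and E :: "('a \<times> 'a) set"
  assumes countable_V: "countable V"
    and edges: "E \<subseteq> V \<times> V"
    and sym_E: "sym E"
    and finite_nbrs: "u \<in> V \<Longrightarrow> finite (E `` {u})"
    and nonisolated: "u \<in> V \<Longrightarrow> E `` {u} \<noteq> {}"
begin

text \<open>
  The squared norm of the restriction to \<open>F\<close> in \<open>\<ell>\<^sup>2(G, deg)\<close>. All norm estimates are phrased with finite \<open>F\<close>,
  so that only finite sums occur.
\<close>

definition energy :: "'a set \<Rightarrow> ('a \<Rightarrow> complex) \<Rightarrow> real" where
  "energy F f = (\<Sum>u\<in>F. (cmod (f u))\<^sup>2 * real (vdegree E u))"

definition energy_le :: "('a \<Rightarrow> complex) \<Rightarrow> real \<Rightarrow> bool" where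
  "energy_le f C \<longleftrightarrow> (\<forall>F. finite F \<and> F \<subseteq> V \<longrightarrow> energy F f \<le> C)"

lemma degree_ge_1: "u \<in> V \<Longrightarrow> 1 \<le> vdegree E u"
  using finite_nbrs[of u] nonisolated[of u] by (simp add: vdegree_def Suc_le_eq card_gt_0_iff)

lemma finite_Image: "finite F \<Longrightarrow> F \<subseteq> V \<Longrightarrow> finite (E `` F)"
  using finite_nbrs by (subst Image_eq_UN) auto

lemma Image_subset_V: "E `` F \<subseteq> V"
  using edges by auto

lemma energy_nonneg: "0 \<le> energy F f"
  unfolding energy_def by (intro sum_nonneg) auto

lemma energy_mono: "finite G \<Longrightarrow> F \<subseteq> G \<Longrightarrow> energy F f \<le> energy G f"
  unfolding energy_def by (intro sum_mono2) auto

lemma energy_superset_support: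
  assumes "finite G" "F \<subseteq> G" "\<And>u. u \<in> G - F \<Longrightarrow> f u = 0"
  shows "energy G f = energy F f"
  unfolding energy_def using assms by (intro sum.mono_neutral_right) auto

lemma energy_cong: "(\<And>u. u \<in> F \<Longrightarrow> f u = g u) \<Longrightarrow> energy F f = energy F g"
  unfolding energy_def by (intro sum.cong) auto

lemma energy_le_nonneg: "energy_le f C \<Longrightarrow> 0 \<le> C"
  unfolding energy_le_def using energy_nonneg[of "{}" f] by (metis empty_subsetI finite.emptyI order_trans)

lemma cmod_le_of_energy_le:
  assumes "energy_le f C" "u \<in> V"
  shows "cmod (f u) \<le> sqrt C"
proof (rule real_le_rsqrt)
  have "(cmod (f u))\<^sup>2 * 1 \<le> (cmod (f u))\<^sup>2 * real (vdegree E u)"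
    using degree_ge_1[OF assms(2)] by (intro mult_left_mono) auto
  also have "\<dots> = energy {u} f" by (simp add: energy_def)
  also have "\<dots> \<le> C" using assms by (simp add: energy_le_def)
  finally show "(cmod (f u))\<^sup>2 \<le> C" by simp
qed

lemma sqrt_energy_add: "sqrt (energy F (\<lambda>u. f u + g u)) \<le> sqrt (energy F f) + sqrt (energy F g)"
proof -
  have eq: "sqrt (energy F f) = L2_set (\<lambda>u. cmod (f u) * sqrt (real (vdegree E u))) F" for f
    by (simp add: energy_def L2_set_def power_mult_distrib)
  have "L2_set (\<lambda>u. cmod (f u + g u) * sqrt (real (vdegree E u))) F
      \<le> L2_set (\<lambda>u. cmod (f u) * sqrt (real (vdegree E u)) + cmod (g u) * sqrt (real (vdegree E u))) F"
    by (intro L2_set_mono) (auto simp: distrib_right[symmetric] intro!: mult_right_mono norm_triangle_ineq)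
  also have "\<dots> \<le> sqrt (energy F f) + sqrt (energy F g)"
    unfolding eq by (rule L2_set_triangle_ineq)
  finally show ?thesis by (simp add: eq)
qed

lemma energy_cmult: "energy F (\<lambda>u. a * f u) = (cmod a)\<^sup>2 * energy F f"
  by (simp add: energy_def norm_mult power_mult_distrib sum_distrib_left mult_ac)

lemma sqrt_energy_sum:
  "sqrt (energy F (\<lambda>u. \<Sum>n<(N::nat). a n u)) \<le> (\<Sum>n<N. sqrt (energy F (a n)))"
proof (induction N)
  case 0
  then show ?case by (simp add: energy_def)
next
  case (Suc N)
  have "sqrt (energy F (\<lambda>u. (\<Sum>n<N. a n u) + a N u)) \<le> sqrt (energy F (\<lambda>u. \<Sum>n<N. a n u)) + sqrt (energy F (a N))"
    by (rule sqrt_energy_add)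
  with Suc show ?case by simp
qed

text \<open>
  Double counting: \<open>v\<close> occurs at most once for each of its neighbours.
\<close>

lemma sum_edges_le:
  assumes F: "finite F" "F \<subseteq> V" and g: "\<And>v. 0 \<le> g v"
  shows "(\<Sum>u\<in>F. \<Sum>v\<in>E `` {u}. g v) \<le> (\<Sum>v\<in>E `` F. g v * real (vdegree E v))"
proof -
  have fin: "finite (E `` F)" by (rule finite_Image[OF F])
  have "(\<Sum>u\<in>F. \<Sum>v\<in>E `` {u}. g v) = (\<Sum>u\<in>F. \<Sum>v\<in>E `` F. if (u, v) \<in> E then g v else 0)"
  proof (rule sum.cong[OF refl])
    fix u assume "u \<in> F"
    then have "{v \<in> E `` F. (u, v) \<in> E} = E `` {u}" by auto
    then show "(\<Sum>v\<in>E `` {u}. g v) = (\<Sum>v\<in>E `` F. if (u, v) \<in> E then g v else 0)"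
      using fin by (simp add: sum.inter_filter[symmetric])
  qed
  also have "\<dots> = (\<Sum>v\<in>E `` F. \<Sum>u\<in>F. if (u, v) \<in> E then g v else 0)"
    by (rule sum.swap)
  also have "\<dots> \<le> (\<Sum>v\<in>E `` F. g v * real (vdegree E v))"
  proof (rule sum_mono)
    fix v assume v: "v \<in> E `` F"
    have "{u \<in> F. (u, v) \<in> E} \<subseteq> E `` {v}" using sym_E by (auto simp: sym_def)
    moreover have "finite (E `` {v})" using finite_nbrs v edges by blast
    ultimately have "card {u \<in> F. (u, v) \<in> E} \<le> vdegree E v"
      unfolding vdegree_def by (intro card_mono)
    then have "real (card {u \<in> F. (u, v) \<in> E}) * g v \<le> real (vdegree E v) * g v"
      using g[of v] by (intro mult_right_mono) auto
    moreover have "(\<Sum>u\<in>F. if (u, v) \<in> E then g v else 0) = real (card {u \<in> F. (u, v) \<in> E}) * g v"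
      using F(1) by (simp add: sum.inter_filter[symmetric])
    ultimately show "(\<Sum>u\<in>F. if (u, v) \<in> E then g v else 0) \<le> g v * real (vdegree E v)"
      by (simp add: mult.commute)
  qed
  finally show ?thesis .
qed

text \<open>
  By Cauchy-Schwarz, \<open>deg u\<close> times the squared average over the neighbours is at most the sum
  of squares over the neighbours.
\<close>

lemma energy_markov_op:
  assumes F: "finite F" "F \<subseteq> V"
  shows "energy F (markov_op E f) \<le> energy (E `` F) f"
proof -
  have "energy F (markov_op E f) \<le> (\<Sum>u\<in>F. \<Sum>v\<in>E `` {u}. (cmod (f v))\<^sup>2)"
    unfolding energy_def
  proof (rule sum_mono)
    fix u assume "u \<in> F"
    then have uV: "u \<in> V" using F by auto
    define n where "n = vdegree E u"
    have n: "n \<ge> 1" unfolding n_def by (rule degree_ge_1[OF uV])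
    have "(cmod (\<Sum>v\<in>E `` {u}. f v))\<^sup>2 \<le> (\<Sum>v\<in>E `` {u}. cmod (f v) * 1)\<^sup>2"
      by (intro power_mono) (auto intro: norm_sum)
    also have "\<dots> \<le> (\<Sum>v\<in>E `` {u}. (cmod (f v))\<^sup>2) * (\<Sum>v\<in>E `` {u}. 1\<^sup>2)"
      by (rule Cauchy_Schwarz_ineq_sum)
    also have "\<dots> = (\<Sum>v\<in>E `` {u}. (cmod (f v))\<^sup>2) * real n"
      by (simp add: n_def vdegree_def)
    finally have *: "(cmod (\<Sum>v\<in>E `` {u}. f v))\<^sup>2 \<le> (\<Sum>v\<in>E `` {u}. (cmod (f v))\<^sup>2) * real n" .
    have "(cmod (markov_op E f u))\<^sup>2 * real n = (cmod (\<Sum>v\<in>E `` {u}. f v))\<^sup>2 / real n"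
      using n by (simp add: markov_op_def n_def norm_divide power_divide power2_eq_square)
    also have "\<dots> \<le> (\<Sum>v\<in>E `` {u}. (cmod (f v))\<^sup>2)"
      using * n by (simp add: divide_le_eq)
    finally show "(cmod (markov_op E f u))\<^sup>2 * real (vdegree E u) \<le> (\<Sum>v\<in>E `` {u}. (cmod (f v))\<^sup>2)"
      by (simp add: n_def)
  qed
  also have "\<dots> \<le> energy (E `` F) f"
    unfolding energy_def by (rule sum_edges_le[OF F]) auto
  finally show ?thesis .
qed

lemma energy_resolvent_op:
  assumes F: "finite F" "F \<subseteq> V"
  shows "energy F (resolvent_op E c f) \<le> 2 * ((cmod c)\<^sup>2 + 1) * energy (F \<union> E `` F) f"
proof -
  have fin: "finite (F \<union> E `` F)" using F finite_Image by auto
  have "energy F (resolvent_op E c f) \<le> (\<Sum>u\<in>F. 2 * (cmod c)\<^sup>2 * ((cmod (f u))\<^sup>2 * real (vdegree E u))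
            + 2 * ((cmod (markov_op E f u))\<^sup>2 * real (vdegree E u)))"
    unfolding energy_def
  proof (rule sum_mono)
    fix u
    define m where "m = markov_op E f u"
    have "(cmod (c * f u - m))\<^sup>2 \<le> (cmod (c * f u) + cmod m)\<^sup>2"
      by (intro power_mono norm_triangle_ineq4) auto
    also have "\<dots> \<le> 2 * (cmod (c * f u))\<^sup>2 + 2 * (cmod m)\<^sup>2"
      using sum_squares_bound[of "cmod (c * f u)" "cmod m"] by (simp add: power2_sum)
    finally have "(cmod (resolvent_op E c f u))\<^sup>2 \<le> 2 * (cmod c)\<^sup>2 * (cmod (f u))\<^sup>2 + 2 * (cmod m)\<^sup>2"
      by (simp add: resolvent_op_def m_def norm_mult power_mult_distrib)
    then have "(cmod (resolvent_op E c f u))\<^sup>2 * real (vdegree E u)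
       \<le> (2 * (cmod c)\<^sup>2 * (cmod (f u))\<^sup>2 + 2 * (cmod m)\<^sup>2) * real (vdegree E u)"
      by (intro mult_right_mono) auto
    then show "(cmod (resolvent_op E c f u))\<^sup>2 * real (vdegree E u)
        \<le> 2 * (cmod c)\<^sup>2 * ((cmod (f u))\<^sup>2 * real (vdegree E u))
            + 2 * ((cmod (markov_op E f u))\<^sup>2 * real (vdegree E u))"
      unfolding m_def by (simp add: algebra_simps)
  qed
  also have "\<dots> = 2 * (cmod c)\<^sup>2 * energy F f + 2 * energy F (markov_op E f)"
    by (simp add: energy_def sum.distrib sum_distrib_left)
  also have "\<dots> \<le> 2 * (cmod c)\<^sup>2 * energy (F \<union> E `` F) f + 2 * energy (F \<union> E `` F) f"
    using energy_markov_op[OF F, of f] energy_mono[OF fin, of "E `` F" f] energy_mono[OF fin, of F f]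
    by (intro add_mono mult_left_mono) auto
  finally show ?thesis by (simp add: algebra_simps)
qed

lemma energy_le_resolvent_op:
  assumes "energy_le f C"
  shows "energy_le (resolvent_op E c f) (2 * ((cmod c)\<^sup>2 + 1) * C)"
  unfolding energy_le_def
proof (intro allI impI, elim conjE)
  fix F assume F: "finite F" "F \<subseteq> V"
  have "energy (F \<union> E `` F) f \<le> C"
    using assms F finite_Image[OF F] Image_subset_V[of F] by (auto simp: energy_le_def)
  then have "2 * ((cmod c)\<^sup>2 + 1) * energy (F \<union> E `` F) f \<le> 2 * ((cmod c)\<^sup>2 + 1) * C"
    by (intro mult_left_mono) auto
  then show "energy F (resolvent_op E c f) \<le> 2 * ((cmod c)\<^sup>2 + 1) * C"
    using energy_resolvent_op[OF F, of c f] by linarith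
qed

text \<open>
  Both sides are the sum of \<open>f v * cnj (g u)\<close> over the edges inside \<open>F\<close>, as the weights
  cancel the denominators.
\<close>

lemma markov_op_selfadjoint:
  assumes F: "finite F" "F \<subseteq> V" and f: "\<And>u. u \<notin> F \<Longrightarrow> f u = 0" and g: "\<And>u. u \<notin> F \<Longrightarrow> g u = 0"
  shows "(\<Sum>u\<in>F. markov_op E f u * cnj (g u) * of_nat (vdegree E u))
       = (\<Sum>u\<in>F. f u * cnj (markov_op E g u) * of_nat (vdegree E u))"
proof -
  have sumE: "(\<Sum>v\<in>E `` {u}. h v) = (\<Sum>v\<in>F. if (u, v) \<in> E then h v else 0)"
    if "u \<in> F" "\<And>u. u \<notin> F \<Longrightarrow> h u = 0" for u and h :: "'a \<Rightarrow> complex"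
  proof -
    have "finite (E `` {u})" using that(1) F finite_nbrs by auto
    then have "(\<Sum>v\<in>E `` {u}. h v) = (\<Sum>v\<in>F \<inter> E `` {u}. h v)"
      using that by (intro sum.mono_neutral_right) auto
    also have "F \<inter> E `` {u} = {v \<in> F. (u, v) \<in> E}" by auto
    also have "(\<Sum>v\<in>{v \<in> F. (u, v) \<in> E}. h v) = (\<Sum>v\<in>F. if (u, v) \<in> E then h v else 0)"
      using F by (simp add: sum.inter_filter)
    finally show ?thesis .
  qed
  have deg: "markov_op E h u * of_nat (vdegree E u) = (\<Sum>v\<in>E `` {u}. h v)" if "u \<in> F" for u h
    using degree_ge_1[of u] that F by (auto simp: markov_op_def)
  have deg': "cnj (markov_op E h u) * of_nat (vdegree E u) = cnj (\<Sum>v\<in>E `` {u}. h v)" if "u \<in> F" for u h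
    using arg_cong[OF deg[OF that, of h], of cnj] by simp
  have "(\<Sum>u\<in>F. markov_op E f u * cnj (g u) * of_nat (vdegree E u))
      = (\<Sum>u\<in>F. \<Sum>v\<in>F. if (u, v) \<in> E then f v * cnj (g u) else 0)"
  proof (rule sum.cong[OF refl])
    fix u assume u: "u \<in> F"
    have "markov_op E f u * cnj (g u) * of_nat (vdegree E u) = (\<Sum>v\<in>E `` {u}. f v) * cnj (g u)"
      unfolding deg[OF u, symmetric] by simp
    also have "\<dots> = (\<Sum>v\<in>F. if (u, v) \<in> E then f v * cnj (g u) else 0)"
      by (subst sumE[OF u, of f, OF f]) (auto simp: sum_distrib_right intro!: sum.cong)
    finally show "markov_op E f u * cnj (g u) * of_nat (vdegree E u)
        = (\<Sum>v\<in>F. if (u, v) \<in> E then f v * cnj (g u) else 0)" .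
  qed
  also have "\<dots> = (\<Sum>v\<in>F. \<Sum>u\<in>F. if (u, v) \<in> E then f v * cnj (g u) else 0)"
    by (rule sum.swap)
  also have "\<dots> = (\<Sum>v\<in>F. f v * cnj (markov_op E g v) * of_nat (vdegree E v))"
  proof (rule sum.cong[OF refl])
    fix v assume v: "v \<in> F"
    have "f v * cnj (markov_op E g v) * of_nat (vdegree E v) = f v * cnj (\<Sum>u\<in>E `` {v}. g u)"
      unfolding deg'[OF v, symmetric] by simp
    also have "\<dots> = (\<Sum>u\<in>F. if (v, u) \<in> E then f v * cnj (g u) else 0)"
      by (subst sumE[OF v, of g, OF g]) (auto simp: sum_distrib_left intro!: sum.cong)
    also have "\<dots> = (\<Sum>u\<in>F. if (u, v) \<in> E then f v * cnj (g u) else 0)"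
      using sym_E by (intro sum.cong) (auto simp: sym_def)
    finally show "(\<Sum>u\<in>F. if (u, v) \<in> E then f v * cnj (g u) else 0) = f v * cnj (markov_op E g v) * of_nat (vdegree E v)"
      by simp
  qed
  finally show ?thesis .
qed

lemma resolvent_op_adjoint:
  assumes F: "finite F" "F \<subseteq> V" and f: "\<And>u. u \<notin> F \<Longrightarrow> f u = 0" and g: "\<And>u. u \<notin> F \<Longrightarrow> g u = 0"
  shows "(\<Sum>u\<in>F. resolvent_op E c f u * cnj (g u) * of_nat (vdegree E u))
       = (\<Sum>u\<in>F. f u * cnj (resolvent_op E (cnj c) g u) * of_nat (vdegree E u))"
proof -
  have "(\<Sum>u\<in>F. resolvent_op E c f u * cnj (g u) * of_nat (vdegree E u))
     = (\<Sum>u\<in>F. c * f u * cnj (g u) * of_nat (vdegree E u)) - (\<Sum>u\<in>F. markov_op E f u * cnj (g u) * of_nat (vdegree E u))"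
    by (simp add: resolvent_op_def left_diff_distrib sum_subtractf)
  also have "(\<Sum>u\<in>F. markov_op E f u * cnj (g u) * of_nat (vdegree E u))
       = (\<Sum>u\<in>F. f u * cnj (markov_op E g u) * of_nat (vdegree E u))"
    by (rule markov_op_selfadjoint[OF F f g])
  also have "(\<Sum>u\<in>F. c * f u * cnj (g u) * of_nat (vdegree E u)) - \<dots>
      = (\<Sum>u\<in>F. f u * cnj (resolvent_op E (cnj c) g u) * of_nat (vdegree E u))"
    by (simp add: resolvent_op_def left_diff_distrib right_diff_distrib sum_subtractf mult_ac)
  finally show ?thesis .
qed

text \<open>
  The iteration operator \<open>I - t A\<^sup>* A\<close> for \<open>A = c - \<M>\<close>, known from Richardson's method for the normal equation.
\<close>

definition richardson :: "complex \<Rightarrow> real \<Rightarrow> ('a \<Rightarrow> complex) \<Rightarrow> 'a \<Rightarrow> complex" where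
  "richardson c t f u = f u - of_real t * resolvent_op E (cnj c) (resolvent_op E c f) u"

lemma resolvent_op_support:
  assumes "\<And>u. u \<notin> S \<Longrightarrow> f u = 0" "u \<notin> S \<union> E `` S"
  shows "resolvent_op E c f u = 0"
proof -
  have "f v = 0" if "v \<in> E `` {u}" for v
    using assms that sym_E by (auto simp: sym_def)
  then show ?thesis using assms by (simp add: resolvent_op_def markov_op_def)
qed

text \<open>
  Expanding the square gives
  \<open>\<parallel>f\<parallel>\<^sup>2 - 2 t \<parallel>A f\<parallel>\<^sup>2 + t\<^sup>2 \<parallel>A\<^sup>* A f\<parallel>\<^sup>2\<close>. The bound \<open>\<parallel>A\<^sup>*\<parallel>\<^sup>2 \<le> L\<close> and the choice \<open>t = 1 / L\<close> leave
  at most \<open>\<parallel>f\<parallel>\<^sup>2 - t \<parallel>A f\<parallel>\<^sup>2\<close>, to which the lower bound for \<open>A\<close> applies.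
\<close>

lemma energy_richardson_finite_support:
  assumes S: "finite S" "S \<subseteq> V" and f: "\<And>u. u \<notin> S \<Longrightarrow> f u = 0"
    and F: "finite F" "F \<subseteq> V" "S \<union> E `` S \<subseteq> F"
    and L: "L = 2 * ((cmod c)\<^sup>2 + 1)"
    and below: "energy F f \<le> K * energy F (resolvent_op E c f)" and K: "K > 0"
  shows "energy F (richardson c (1 / L) f) \<le> (1 - 1 / (L * K)) * energy F f"
proof -
  have L0: "L > 0" unfolding L by (simp add: add_nonneg_pos)
  define A where "A = resolvent_op E c f"
  define H where "H = resolvent_op E (cnj c) A"
  have f': "f u = 0" if "u \<notin> F" for u using that F(3) f by blast
  have A': "A u = 0" if "u \<notin> F" for u
    unfolding A_def using that F(3) by (intro resolvent_op_support[of S f, OF f]) auto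
  have "(\<Sum>u\<in>F. A u * cnj (A u) * of_nat (vdegree E u)) = (\<Sum>u\<in>F. f u * cnj (H u) * of_nat (vdegree E u))"
    unfolding H_def using resolvent_op_adjoint[OF F(1,2), of f A c] f' A' unfolding A_def by blast
  then have *: "Re (\<Sum>u\<in>F. A u * cnj (A u) * of_nat (vdegree E u)) = Re (\<Sum>u\<in>F. f u * cnj (H u) * of_nat (vdegree E u))"
    by (rule arg_cong)
  have ReA: "Re (A u * cnj (A u) * of_nat (vdegree E u)) = (cmod (A u))\<^sup>2 * real (vdegree E u)" for u
    by (simp flip: complex_norm_square)
  have Ref: "Re (f u * cnj (H u) * of_nat (vdegree E u)) = Re (f u * cnj (H u)) * real (vdegree E u)" for u
    by simp
  have adj: "(\<Sum>u\<in>F. Re (f u * cnj (H u)) * real (vdegree E u)) = energy F A"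
    using * unfolding Re_sum ReA Ref energy_def by simp
  have "energy F H \<le> L * energy (F \<union> E `` F) A"
    using energy_resolvent_op[OF F(1,2), of "cnj c" A] by (simp add: H_def L)
  also have "energy (F \<union> E `` F) A = energy F A"
    using A' F finite_Image[OF F(1,2)] by (intro energy_superset_support) auto
  finally have H: "energy F H \<le> L * energy F A" .
  \<comment> \<open>The cross term is summed with the help of the adjoint.\<close>
  have sq: "(cmod (x - of_real t * y))\<^sup>2 = (cmod x)\<^sup>2 - 2 * t * Re (x * cnj y) + t\<^sup>2 * (cmod y)\<^sup>2" for x y :: complex and t :: real
    unfolding cmod_power2 by (simp add: power2_eq_square algebra_simps)
  have "energy F (richardson c (1 / L) f) = (\<Sum>u\<in>F. (cmod (f u))\<^sup>2 * real (vdegree E u)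
       - 2 * (1 / L) * (Re (f u * cnj (H u)) * real (vdegree E u)) + (1 / L)\<^sup>2 * ((cmod (H u))\<^sup>2 * real (vdegree E u)))"
    unfolding energy_def richardson_def H_def[symmetric] A_def[symmetric] sq
    by (intro sum.cong refl) (simp add: algebra_simps)
  also have "\<dots> = energy F f - 2 * (1 / L) * energy F A + (1 / L)\<^sup>2 * energy F H"
    unfolding adj[symmetric] by (simp add: energy_def sum.distrib sum_subtractf sum_distrib_left)
  also have "\<dots> \<le> energy F f - 2 * (1 / L) * energy F A + (1 / L)\<^sup>2 * (L * energy F A)"
    using H by (intro add_left_mono mult_left_mono) auto
  also have "\<dots> = energy F f - energy F A / L"
    using L0 by (simp add: power2_eq_square field_simps)
  also have "\<dots> \<le> energy F f - (energy F f / K) / L"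
  proof -
    have "energy F f / K \<le> energy F A" using below K by (simp add: A_def divide_le_eq mult.commute)
    from divide_right_mono[OF this, of L] show ?thesis using L0 by simp
  qed
  also have "\<dots> = (1 - 1 / (L * K)) * energy F f"
    by (simp add: algebra_simps)
  finally show ?thesis .
qed

lemma resolvent_op_cong:
  "(\<And>v. v \<in> insert u (E `` {u}) \<Longrightarrow> f v = g v) \<Longrightarrow> resolvent_op E c f u = resolvent_op E c g u"
  by (simp add: resolvent_op_def markov_op_def)

lemma richardson_cong:
  assumes "\<And>v. v \<in> insert u (E `` {u}) \<union> E `` insert u (E `` {u}) \<Longrightarrow> f v = g v"
  shows "richardson c t f u = richardson c t g u"
proof -
  have "resolvent_op E (cnj c) (resolvent_op E c f) u = resolvent_op E (cnj c) (resolvent_op E c g) u"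
  proof (intro resolvent_op_cong)
    fix v w assume "v \<in> insert u (E `` {u})" "w \<in> insert v (E `` {v})"
    then show "f w = g w" by (intro assms) blast
  qed
  then show ?thesis using assms by (simp add: richardson_def)
qed

text \<open>
  The contraction passes from finitely supported functions to all square-summable ones: on a finite set
  the operator sees only the values within distance two, so \<open>f\<close> may be cut off there.
\<close>

lemma energy_le_richardson:
  assumes below: "\<And>f F. finite F \<Longrightarrow> F \<subseteq> V \<Longrightarrow> {u. f u \<noteq> 0} \<union> E `` {u. f u \<noteq> 0} \<subseteq> F \<Longrightarrow>
      energy F f \<le> K * energy F (resolvent_op E c f)" and K: "K \<ge> 1"
    and L: "L = 2 * ((cmod c)\<^sup>2 + 1)" and f: "energy_le f C"
  shows "energy_le (richardson c (1 / L) f) ((1 - 1 / (L * K)) * C)"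
  unfolding energy_le_def
proof (intro allI impI, elim conjE)
  fix F assume F: "finite F" "F \<subseteq> V"
  define N where "N = (\<lambda>S. S \<union> E `` S)"
  have N: "finite (N S)" "N S \<subseteq> V" if "finite S" "S \<subseteq> V" for S
    using that finite_Image[OF that] Image_subset_V[of S] by (auto simp: N_def)
  define S where "S = N (N F)"
  define g where "g = (\<lambda>u. if u \<in> S then f u else 0)"
  have S: "finite S" "S \<subseteq> V" using N F by (auto simp: S_def)
  have FS: "F \<subseteq> N S" "S \<subseteq> N S" by (auto simp: S_def N_def)
  have L2: "L \<ge> 2" using L by simp
  have "1 \<le> L * K" using L2 K mult_mono[of 1 L 1 K] by simp
  then have \<rho>: "0 \<le> 1 - 1 / (L * K)" by (simp add: divide_le_eq)
  have "energy F (richardson c (1 / L) f) = energy F (richardson c (1 / L) g)"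
  proof (intro energy_cong richardson_cong)
    fix u v assume "u \<in> F" "v \<in> insert u (E `` {u}) \<union> E `` insert u (E `` {u})"
    then have "v \<in> S" by (auto simp: S_def N_def)
    then show "f v = g v" by (simp add: g_def)
  qed
  also have "\<dots> \<le> energy (N S) (richardson c (1 / L) g)"
    using N[OF S] FS by (intro energy_mono) auto
  also have "\<dots> \<le> (1 - 1 / (L * K)) * energy (N S) g"
  proof (rule energy_richardson_finite_support[OF S])
    show "energy (N S) g \<le> K * energy (N S) (resolvent_op E c g)"
      using N[OF S] by (intro below) (auto simp: N_def g_def split: if_splits)
  qed (use N[OF S] K L in \<open>auto simp: g_def N_def\<close>)
  also have "energy (N S) g = energy S g"
    using N[OF S] FS by (intro energy_superset_support) (auto simp: g_def)
  also have "\<dots> = energy S f" by (intro energy_cong) (auto simp: g_def)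
  also have "(1 - 1 / (L * K)) * energy S f \<le> (1 - 1 / (L * K)) * C"
    using f S \<rho> by (intro mult_left_mono) (auto simp: energy_le_def)
  finally show "energy F (richardson c (1 / L) f) \<le> (1 - 1 / (L * K)) * C" by simp
qed

lemma richardson_add: "richardson c t (\<lambda>u. f u + g u) = (\<lambda>u. richardson c t f u + richardson c t g u)"
  by (simp add: richardson_def resolvent_op_add fun_eq_iff algebra_simps)

lemma richardson_cmult: "richardson c t (\<lambda>u. a * f u) = (\<lambda>u. a * richardson c t f u)"
  by (simp add: richardson_def resolvent_op_cmult fun_eq_iff algebra_simps)

lemma richardson_resolvent_op:
  "richardson c t (resolvent_op E d f) = resolvent_op E d (richardson c t f)"
proof -
  have "resolvent_op E d (richardson c t f)
     = (\<lambda>u. resolvent_op E d f u - of_real t * resolvent_op E d (resolvent_op E (cnj c) (resolvent_op E c f)) u)"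
    by (simp add: richardson_def[abs_def] resolvent_op_diff resolvent_op_cmult)
  also have "\<dots> = richardson c t (resolvent_op E d f)"
    by (simp add: richardson_def fun_eq_iff resolvent_op_commute[of _ d])
  finally show ?thesis ..
qed

lemma richardson_pow_resolvent_op:
  "(richardson c t ^^ n) (resolvent_op E d f) = resolvent_op E d ((richardson c t ^^ n) f)"
  by (induction n) (simp_all add: richardson_resolvent_op)

lemma richardson_pow_add:
  "(richardson c t ^^ n) (\<lambda>u. f u + g u) = (\<lambda>u. (richardson c t ^^ n) f u + (richardson c t ^^ n) g u)"
  by (induction n) (simp_all add: richardson_add)

lemma richardson_pow_cmult:
  "(richardson c t ^^ n) (\<lambda>u. a * f u) = (\<lambda>u. a * (richardson c t ^^ n) f u)"
  by (induction n) (simp_all add: richardson_cmult)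

lemma resolvent_op_cong_V:
  assumes "\<And>v. v \<in> V \<Longrightarrow> f v = g v" "u \<in> V"
  shows "resolvent_op E c f u = resolvent_op E c g u"
  using assms edges by (intro resolvent_op_cong) auto

lemma richardson_pow_cong_V:
  assumes "\<And>v. v \<in> V \<Longrightarrow> f v = g v" "u \<in> V"
  shows "(richardson c t ^^ n) f u = (richardson c t ^^ n) g u"
  using assms(2)
proof (induction n arbitrary: u)
  case (Suc n)
  have "richardson c t ((richardson c t ^^ n) f) u = richardson c t ((richardson c t ^^ n) g) u"
    using Suc edges by (intro richardson_cong) auto
  then show ?case by simp
qed (use assms in simp)

definition degree_measure :: "'a measure" where
  "degree_measure = point_measure V (\<lambda>u. ennreal (real (vdegree E u)))"

lemma AE_degree_measure: "(AE u in degree_measure. P u) \<longleftrightarrow> (\<forall>u\<in>V. P u)"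
proof -
  have "0 < vdegree E u" if "u \<in> V" for u using degree_ge_1[OF that] by simp
  then show ?thesis unfolding degree_measure_def AE_point_measure by auto
qed

lemma nn_integral_degree_measure:
  "(\<integral>\<^sup>+u. ennreal ((cmod (f u))\<^sup>2) \<partial>degree_measure) = (\<integral>\<^sup>+u. ennreal ((cmod (f u))\<^sup>2 * real (vdegree E u)) \<partial>count_space V)"
  unfolding degree_measure_def point_measure_def
  by (subst nn_integral_density) (simp_all add: ennreal_mult' mult.commute)

lemma ennreal_energy:
  assumes "finite F" "F \<subseteq> V"
  shows "ennreal (energy F f) = (\<integral>\<^sup>+u. ennreal ((cmod (f u))\<^sup>2 * real (vdegree E u)) * indicator F u \<partial>count_space V)"
proof -
  have "(\<integral>\<^sup>+u. ennreal ((cmod (f u))\<^sup>2 * real (vdegree E u)) * indicator F u \<partial>count_space V)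
      = (\<Sum>u\<in>F. ennreal ((cmod (f u))\<^sup>2 * real (vdegree E u)) * indicator F u)"
    using assms by (intro nn_integral_count_space') auto
  also have "\<dots> = (\<Sum>u\<in>F. ennreal ((cmod (f u))\<^sup>2 * real (vdegree E u)))"
    by (intro sum.cong) auto
  also have "\<dots> = ennreal (energy F f)"
    unfolding energy_def by (intro sum_ennreal) auto
  finally show ?thesis ..
qed

lemma borel_measurable_degree_measure: "f \<in> borel_measurable degree_measure"
  by (simp add: degree_measure_def)

lemma L2_imp_energy_le:
  assumes "f \<in> L2 degree_measure"
  shows "energy_le f ((L2norm degree_measure f)\<^sup>2)"
  unfolding energy_le_def
proof (intro allI impI, elim conjE)
  fix F assume F: "finite F" "F \<subseteq> V"
  have int: "integrable degree_measure (\<lambda>u. (cmod (f u))\<^sup>2)" using assms by (simp add: L2_def)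
  have "ennreal (energy F f) \<le> (\<integral>\<^sup>+u. ennreal ((cmod (f u))\<^sup>2 * real (vdegree E u)) \<partial>count_space V)"
    unfolding ennreal_energy[OF F] by (intro nn_integral_mono) (auto simp: indicator_def)
  also have "\<dots> = (\<integral>\<^sup>+u. ennreal ((cmod (f u))\<^sup>2) \<partial>degree_measure)"
    by (rule nn_integral_degree_measure[symmetric])
  also have "\<dots> = ennreal (\<integral>u. (cmod (f u))\<^sup>2 \<partial>degree_measure)"
    using int by (intro nn_integral_eq_integral) auto
  finally have "energy F f \<le> (\<integral>u. (cmod (f u))\<^sup>2 \<partial>degree_measure)"
    by (simp add: ennreal_le_iff integral_nonneg_AE)
  then show "energy F f \<le> (L2norm degree_measure f)\<^sup>2"
    by (simp add: L2norm_def integral_nonneg_AE)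
qed

lemma energy_le_imp_L2:
  assumes "energy_le f C"
  shows "f \<in> L2 degree_measure" "L2norm degree_measure f \<le> sqrt C"
proof -
  have C: "C \<ge> 0" by (rule energy_le_nonneg[OF assms])
  define V' where "V' = (\<lambda>n. V \<inter> from_nat_into V ` {..<n::nat})"
  have V': "finite (V' n)" "V' n \<subseteq> V" for n by (auto simp: V'_def)
  define h where "h = (\<lambda>u. ennreal ((cmod (f u))\<^sup>2 * real (vdegree E u)))"
  have "(\<integral>\<^sup>+u. h u \<partial>count_space V) = (\<integral>\<^sup>+u. (SUP n. h u * indicator (V' n) u) \<partial>count_space V)"
  proof (rule nn_integral_cong)
    fix u assume "u \<in> space (count_space V)"
    then have u: "u \<in> V" by simp
    then obtain n where n: "u \<in> V' n"
      using from_nat_into_surj[OF countable_V u] by (auto simp: V'_def)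
    show "h u = (SUP n. h u * indicator (V' n) u)"
    proof (rule antisym)
      show "h u \<le> (SUP n. h u * indicator (V' n) u)"
        using n by (intro SUP_upper2[of n]) auto
      show "(SUP n. h u * indicator (V' n) u) \<le> h u"
        by (intro SUP_least) (auto simp: indicator_def)
    qed
  qed
  also have "\<dots> = (SUP n. \<integral>\<^sup>+u. h u * indicator (V' n) u \<partial>count_space V)"
  proof (rule nn_integral_monotone_convergence_SUP)
    show "incseq (\<lambda>n u. h u * indicator (V' n) u)"
      by (auto simp: incseq_def le_fun_def V'_def indicator_def)
  qed auto
  also have "\<dots> = (SUP n. ennreal (energy (V' n) f))"
    using ennreal_energy[OF V'(1) V'(2), of _ f] by (simp add: h_def)
  also have "\<dots> \<le> ennreal C"
    using assms V' by (intro SUP_least ennreal_leI) (auto simp: energy_le_def)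
  finally have le: "(\<integral>\<^sup>+u. ennreal ((cmod (f u))\<^sup>2) \<partial>degree_measure) \<le> ennreal C"
    by (simp add: nn_integral_degree_measure h_def)
  have meas: "(\<lambda>u. (cmod (f u))\<^sup>2) \<in> borel_measurable degree_measure"
    by (simp add: degree_measure_def)
  have int: "integrable degree_measure (\<lambda>u. (cmod (f u))\<^sup>2)"
    using le by (intro integrableI_nonneg meas) (auto intro: le_less_trans)
  then show "f \<in> L2 degree_measure" by (simp add: L2_def borel_measurable_degree_measure)
  have "ennreal (\<integral>u. (cmod (f u))\<^sup>2 \<partial>degree_measure) \<le> ennreal C"
    using le nn_integral_eq_integral[OF int] by simp
  then have "(\<integral>u. (cmod (f u))\<^sup>2 \<partial>degree_measure) \<le> C" using C by (simp add: ennreal_le_iff)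
  then show "L2norm degree_measure f \<le> sqrt C" by (simp add: L2norm_def)
qed

text \<open>
  The inverse of \<open>A = c - \<M>\<close> is the Neumann series \<open>\<Sum>n. t B\<^sup>n A\<^sup>*\<close>. Since \<open>t B\<^sup>n A\<^sup>* A = B\<^sup>n - B\<^sup>n\<^sup>+\<^sup>1\<close> and all operators
  commute, both compositions with \<open>A\<close> telescope to the identity.
\<close>

theorem not_in_graph_spectrum:
  assumes below: "\<And>f F. finite F \<Longrightarrow> F \<subseteq> V \<Longrightarrow> {u. f u \<noteq> 0} \<union> E `` {u. f u \<noteq> 0} \<subseteq> F \<Longrightarrow>
      energy F f \<le> K * energy F (resolvent_op E c f)" and K: "K \<ge> 1"
  shows "c \<notin> graph_spectrum V E"
proof -
  define L where "L = 2 * ((cmod c)\<^sup>2 + 1)"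
  define t where "t = 1 / L"
  define \<rho> where "\<rho> = 1 - 1 / (L * K)"
  define r where "r = sqrt \<rho>"
  define B where "B = richardson c t"
  have L2: "L \<ge> 2" by (simp add: L_def)
  have LK: "1 \<le> L * K" using L2 K mult_mono[of 1 L 1 K] by simp
  then have \<rho>: "0 \<le> \<rho>" "\<rho> < 1" by (simp_all add: \<rho>_def divide_le_eq)
  then have r: "0 \<le> r" "r < 1" by (simp_all add: r_def)
  have t: "t \<ge> 0" using L2 by (simp add: t_def)
  have LC: "2 * ((cmod (cnj c))\<^sup>2 + 1) = L" by (simp add: L_def)
  have powB: "energy_le ((B ^^ n) h) (\<rho> ^ n * C)" if "energy_le h C" for h C n
  proof (induction n)
    case (Suc n)
    have "energy_le (richardson c (1 / L) ((B ^^ n) h)) ((1 - 1 / (L * K)) * (\<rho> ^ n * C))"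
      by (rule energy_le_richardson[OF below K L_def Suc])
    then show ?case by (simp add: B_def t_def \<rho>_def mult.assoc)
  qed (use that in simp)
  have sqrt_pow: "sqrt (\<rho> ^ n * C) = r ^ n * sqrt C" for n C
    by (simp add: r_def real_sqrt_mult real_sqrt_power)
  have bound: "cmod ((B ^^ n) h u) \<le> r ^ n * sqrt C" if "energy_le h C" "u \<in> V" for h C n u
    using cmod_le_of_energy_le[OF powB[OF that(1), of n] that(2)] by (simp add: sqrt_pow)
  have lim: "(\<lambda>n. (B ^^ n) h u) \<longlonglongrightarrow> 0" if "energy_le h C" "u \<in> V" for h C u
  proof (rule Lim_null_comparison)
    show "\<forall>\<^sub>F n in sequentially. cmod ((B ^^ n) h u) \<le> r ^ n * sqrt C"
      using bound[OF that] by (intro always_eventually allI)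
    show "(\<lambda>n. r ^ n * sqrt C) \<longlonglongrightarrow> 0"
      using r by (intro tendsto_mult_left_zero LIMSEQ_realpow_zero)
  qed
  have summ: "summable (\<lambda>n. of_real t * (B ^^ n) h u)" if "energy_le h C" "u \<in> V" for h C u
  proof (rule summable_comparison_test')
    show "summable (\<lambda>n. t * sqrt C * r ^ n)"
      using r by (intro summable_mult summable_geometric) auto
    show "norm (of_real t * (B ^^ n) h u) \<le> t * sqrt C * r ^ n" if "n \<ge> 0" for n
      using mult_left_mono[OF bound[OF \<open>energy_le h C\<close> \<open>u \<in> V\<close>, of n] t] t
      by (simp add: norm_mult mult_ac)
  qed
  define T where "T = (\<lambda>h u. \<Sum>n. of_real t * (B ^^ n) h u)"
  have sums: "(\<lambda>n. of_real t * (B ^^ n) h u) sums T h u" if "energy_le h C" "u \<in> V" for h C u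
    using summable_sums[OF summ[OF that]] by (simp add: T_def)
  \<comment> \<open>The bound for the squared norm of the series, from summing the geometric series of norms.\<close>
  define Q where "Q = (t / (1 - r))\<^sup>2"
  have T_le: "energy_le (T h) (Q * C)" if h: "energy_le h C" for h C
    unfolding energy_le_def
  proof (intro allI impI, elim conjE)
    fix F assume F: "finite F" "F \<subseteq> V"
    have C: "C \<ge> 0" by (rule energy_le_nonneg[OF h])
    have "sqrt (energy F (\<lambda>u. \<Sum>n<N. of_real t * (B ^^ n) h u)) \<le> t * sqrt C / (1 - r)" for N
    proof -
      have "sqrt (energy F (\<lambda>u. \<Sum>n<N. of_real t * (B ^^ n) h u)) \<le> (\<Sum>n<N. sqrt (energy F (\<lambda>u. of_real t * (B ^^ n) h u)))"
        by (rule sqrt_energy_sum)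
      also have "\<dots> \<le> (\<Sum>n<N. t * sqrt C * r ^ n)"
      proof (rule sum_mono)
        fix n
        have "energy F ((B ^^ n) h) \<le> \<rho> ^ n * C" using powB[OF h, of n] F by (simp add: energy_le_def)
        then have "sqrt (energy F ((B ^^ n) h)) \<le> r ^ n * sqrt C" using sqrt_pow[of n C] real_sqrt_le_mono by fastforce
        then have "t * sqrt (energy F ((B ^^ n) h)) \<le> t * (r ^ n * sqrt C)" using t by (intro mult_left_mono)
        then show "sqrt (energy F (\<lambda>u. of_real t * (B ^^ n) h u)) \<le> t * sqrt C * r ^ n"
          using t by (simp add: energy_cmult real_sqrt_mult mult_ac)
      qed
      also have "\<dots> = t * sqrt C * (\<Sum>n<N. r ^ n)" by (simp add: sum_distrib_left)
      also have "\<dots> \<le> t * sqrt C * (1 / (1 - r))"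
      proof (rule mult_left_mono)
        have "(\<Sum>n<N. r ^ n) \<le> (\<Sum>n. r ^ n)" using r by (intro sum_le_suminf summable_geometric) auto
        then show "(\<Sum>n<N. r ^ n) \<le> 1 / (1 - r)" using r by (simp add: suminf_geometric)
      qed (use t C in auto)
      finally show ?thesis by simp
    qed
    then have "energy F (\<lambda>u. \<Sum>n<N. of_real t * (B ^^ n) h u) \<le> (t * sqrt C / (1 - r))\<^sup>2" for N
      using real_sqrt_le_iff sqrt_le_D by blast
    moreover have "(t * sqrt C / (1 - r))\<^sup>2 = Q * C"
      using C by (simp add: Q_def power_mult_distrib power_divide)
    ultimately have le: "energy F (\<lambda>u. \<Sum>n<N. of_real t * (B ^^ n) h u) \<le> Q * C" for N by metis
    have "(\<lambda>N. energy F (\<lambda>u. \<Sum>n<N. of_real t * (B ^^ n) h u)) \<longlonglongrightarrow> energy F (T h)"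
      unfolding energy_def using sums[OF h] F(2)
      by (intro tendsto_intros) (auto simp: sums_def)
    then show "energy F (T h) \<le> Q * C"
      by (rule LIMSEQ_le_const2) (use le in blast)
  qed
  define S where "S = (\<lambda>g. T (resolvent_op E (cnj c) g))"
  have L2D: "energy_le f ((L2norm degree_measure f)\<^sup>2)" if "f \<in> L2 degree_measure" for f
    using L2_imp_energy_le[OF that] .
  have S_sums: "(\<lambda>n. of_real t * (B ^^ n) (resolvent_op E (cnj c) f) u) sums S f u"
    if "energy_le f C" "u \<in> V" for f C u
    unfolding S_def by (rule sums[OF energy_le_resolvent_op[OF that(1)] that(2)])
  have S_le: "energy_le (S f) (Q * (L * C))" if "energy_le f C" for f C
    using T_le[OF energy_le_resolvent_op[OF that, of "cnj c"]] unfolding LC S_def .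
  have step: "of_real t * (B ^^ n) (resolvent_op E (cnj c) (resolvent_op E c f)) u = (B ^^ n) f u - (B ^^ Suc n) f u" for n f u
    unfolding B_def by (simp add: richardson_pow_resolvent_op) (simp add: richardson_def)
  \<comment> \<open>The powers tend to 0 pointwise, so the telescoping series has sum f.\<close>
  have tele: "(\<lambda>n. (B ^^ n) f u - (B ^^ Suc n) f u) sums f u" if "energy_le f C" "u \<in> V" for f C u
    using telescope_sums'[OF lim[OF that]] by simp
  have left: "S (\<lambda>y. c * f y - markov_op E f y) u = f u" if "energy_le f C" "u \<in> V" for f C u
  proof -
    have "(\<lambda>y. c * f y - markov_op E f y) = resolvent_op E c f" by (simp add: fun_eq_iff resolvent_op_def)
    moreover have "S (resolvent_op E c f) u = f u"
      using S_sums[OF energy_le_resolvent_op[OF that(1), where c = c] that(2)] tele[OF that] unfolding step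
      by (rule sums_unique2)
    ultimately show ?thesis by simp
  qed
  have right: "c * S f u - markov_op E (S f) u = f u" if "energy_le f C" "u \<in> V" for f C u
  proof -
    define a where "a = (\<lambda>n u. of_real t * (B ^^ n) (resolvent_op E (cnj c) f) u)"
    have a: "(\<lambda>n. a n v) sums S f v" if "v \<in> V" for v
      unfolding a_def using S_sums[OF \<open>energy_le f C\<close> that] .
    have "(\<lambda>n. c * a n u - (\<Sum>v\<in>E `` {u}. a n v) / of_nat (vdegree E u))
       sums (c * S f u - (\<Sum>v\<in>E `` {u}. S f v) / of_nat (vdegree E u))"
      using edges that(2) by (intro sums_diff sums_mult sums_divide sums_sum a) auto
    moreover have "c * a n u - (\<Sum>v\<in>E `` {u}. a n v) / of_nat (vdegree E u) = (B ^^ n) f u - (B ^^ Suc n) f u" for n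
    proof -
      have "c * a n u - (\<Sum>v\<in>E `` {u}. a n v) / of_nat (vdegree E u) = resolvent_op E c (a n) u"
        by (simp add: resolvent_op_def markov_op_def)
      also have "\<dots> = of_real t * resolvent_op E c ((B ^^ n) (resolvent_op E (cnj c) f)) u"
        by (simp add: a_def resolvent_op_cmult)
      also have "\<dots> = of_real t * (B ^^ n) (resolvent_op E (cnj c) (resolvent_op E c f)) u"
        by (simp add: B_def richardson_pow_resolvent_op resolvent_op_commute[where c = c])
      finally show ?thesis by (simp only: step)
    qed
    ultimately have "(\<lambda>n. (B ^^ n) f u - (B ^^ Suc n) f u) sums (c * S f u - markov_op E (S f) u)"
      by (simp add: markov_op_def)
    then show ?thesis using tele[OF that] by (rule sums_unique2)
  qed
  have "bounded_L2_operator degree_measure S"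
    unfolding bounded_L2_operator_def AE_degree_measure
  proof (intro conjI ballI allI impI)
    fix f assume f: "f \<in> L2 degree_measure"
    show "S f \<in> L2 degree_measure" by (rule energy_le_imp_L2[OF S_le[OF L2D[OF f]]])
  next
    fix f g :: "'a \<Rightarrow> complex" and u assume "\<forall>u\<in>V. f u = g u" "u \<in> V"
    then show "S f u = S g u"
      unfolding S_def T_def B_def
      by (intro suminf_cong arg_cong2[of _ _ _ _ "(*)"] richardson_pow_cong_V resolvent_op_cong_V) auto
  next
    fix f g u assume f: "f \<in> L2 degree_measure" and g: "g \<in> L2 degree_measure" and u: "u \<in> V"
    have "(\<lambda>n. of_real t * (B ^^ n) (resolvent_op E (cnj c) (\<lambda>y. f y + g y)) u) sums (S f u + S g u)"
      using sums_add[OF S_sums[OF L2D[OF f] u] S_sums[OF L2D[OF g] u]]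
      by (simp add: B_def resolvent_op_add richardson_pow_add distrib_left)
    then show "S (\<lambda>y. f y + g y) u = S f u + S g u"
      unfolding S_def T_def by (rule sums_unique[symmetric])
  next
    fix a f u assume f: "f \<in> L2 degree_measure" and u: "u \<in> V"
    have "(\<lambda>n. of_real t * (B ^^ n) (resolvent_op E (cnj c) (\<lambda>y. a * f y)) u) sums (a * S f u)"
      using sums_mult[OF S_sums[OF L2D[OF f] u], of a]
      by (simp add: B_def resolvent_op_cmult richardson_pow_cmult mult_ac)
    then show "S (\<lambda>y. a * f y) u = a * S f u"
      unfolding S_def T_def by (rule sums_unique[symmetric])
  next
    have "L2norm degree_measure (S f) \<le> sqrt (Q * L) * L2norm degree_measure f" if f: "f \<in> L2 degree_measure" for f
    proof -
      have "L2norm degree_measure (S f) \<le> sqrt (Q * (L * (L2norm degree_measure f)\<^sup>2))"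
        by (rule energy_le_imp_L2[OF S_le[OF L2D[OF f]]])
      also have "\<dots> = sqrt (Q * L) * L2norm degree_measure f"
        by (simp add: real_sqrt_mult L2norm_def)
      finally show ?thesis .
    qed
    then show "\<exists>C. \<forall>f\<in>L2 degree_measure. L2norm degree_measure (S f) \<le> C * L2norm degree_measure f"
      by blast
  qed
  then show ?thesis
    unfolding graph_spectrum_def degree_measure_def[symmetric] L2_spectrum_def mem_Collect_eq not_not AE_degree_measure
    using left[OF L2D] right[OF L2D] by blast
qed

end

section \<open>Borel structure of a graphing\<close>

lemma mem_sym_Image_iff: "sym R \<Longrightarrow> x \<in> R `` S \<longleftrightarrow> (\<exists>y \<in> R `` {x}. y \<in> S)"
  by (meson Image_iff Image_singleton_iff symD)

text \<open>
  The union of the null classes is a countable union.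
\<close>

lemma AE_positive_label_class:
  fixes \<tau> :: "'a \<Rightarrow> 'b::countable"
  assumes [measurable]: "\<tau> \<in> M \<rightarrow>\<^sub>M count_space UNIV"
  shows "AE x in M. emeasure M {y \<in> space M. \<tau> y = \<tau> x} > 0"
proof -
  have "AE x in M. \<forall>p. \<tau> x = p \<longrightarrow> emeasure M {y \<in> space M. \<tau> y = p} > 0"
    unfolding AE_all_countable
  proof
    fix p
    show "AE x in M. \<tau> x = p \<longrightarrow> emeasure M {y \<in> space M. \<tau> y = p} > 0"
    proof (cases "emeasure M {y \<in> space M. \<tau> y = p} = 0")
      case True
      have "AE x in M. \<tau> x \<noteq> p"
        by (rule AE_I[of _ _ "{y \<in> space M. \<tau> y = p}"]) (use True in auto)
      then show ?thesis by eventually_elim simp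
    next
      case False
      then show ?thesis by (auto simp: zero_less_iff_neq_zero)
    qed
  qed
  then show ?thesis by auto
qed

context graphing
begin

lemma edges_subset: "E \<subseteq> space M \<times> space M"
  using sets.sets_into_space[OF borel_edges] by (auto simp: space_pair_measure)

lemma finite_neighbours: "finite (E `` {x})"
proof (cases "x \<in> space M")
  case True
  then show ?thesis using bounded_degree by blast
next
  case False
  then have "E `` {x} = {}" using edges_subset by auto
  then show ?thesis by simp
qed

lemma sets_Image:
  assumes "S \<in> sets M"
  shows "E `` S \<in> sets M"
proof -
  obtain D where D: "\<And>x. x \<in> space M \<Longrightarrow> finite (E `` {x}) \<and> vdegree E x \<le> D"
    using bounded_degree by blast
  have "Domain (E \<inter> (space M \<times> S)) \<in> sets M"
  proof (rule measurable_projection_bounded_sections[OF standard_borel])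
    show "E \<inter> (space M \<times> S) \<in> sets (M \<Otimes>\<^sub>M M)"
      using assms borel_edges by (intro sets.Int pair_measureI) auto
    fix x assume "x \<in> space M"
    then have fin: "finite (E `` {x})" and "card (E `` {x}) \<le> D" using D by (auto simp: vdegree_def)
    moreover have "(E \<inter> (space M \<times> S)) `` {x} \<subseteq> E `` {x}" by auto
    ultimately show "finite ((E \<inter> (space M \<times> S)) `` {x}) \<and> card ((E \<inter> (space M \<times> S)) `` {x}) \<le> D"
      by (meson card_mono finite_subset le_trans)
  qed
  moreover have "Domain (E \<inter> (space M \<times> S)) = E `` S"
    using sym_edges edges_subset by (auto simp: sym_def)
  ultimately show ?thesis by simp
qed

text \<open>
  Pairs of points at distance at most \<open>r\<close>; the diagonal is added because a path may stop early.
\<close>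

definition reach :: "nat \<Rightarrow> ('a \<times> 'a) set" where
  "reach r = (Id \<union> E) ^^ r"

lemma reach_0: "reach 0 = Id"
  by (simp add: reach_def)

lemma reach_Suc_Image: "reach (Suc r) `` S = reach r `` S \<union> E `` (reach r `` S)"
  by (auto simp: reach_def)

lemma reach_add: "reach (r + s) = reach r O reach s"
  by (simp add: reach_def relpow_add)

lemma reach_refl: "(x, x) \<in> reach r"
  by (induction r) (auto simp: reach_def)

lemma reach_mono: "r \<le> s \<Longrightarrow> reach r \<subseteq> reach s"
  using reach_add[of r "s - r"] reach_refl[of _ "s - r"] by auto

lemma reach_step: "(x, y) \<in> reach r \<Longrightarrow> (y, z) \<in> E \<Longrightarrow> (x, z) \<in> reach (Suc r)"
  by (auto simp: reach_def)

lemma sym_reach: "sym (reach r)"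
proof (induction r)
  case (Suc r)
  have "sym (Id \<union> E)" using sym_edges by (auto simp: sym_def)
  have "reach (Suc r) = reach r O (Id \<union> E)" by (simp add: reach_def)
  moreover have "reach (Suc r) = (Id \<union> E) O reach r" by (simp add: reach_def relpow_commute)
  ultimately show ?case using Suc \<open>sym (Id \<union> E)\<close> by (metis converse_relcomp sym_conv_converse_eq)
qed (simp add: reach_0 sym_Id)

lemma reach_space: "(x, y) \<in> reach r \<Longrightarrow> x \<in> space M \<Longrightarrow> y \<in> space M"
proof (induction r arbitrary: y)
  case (Suc r)
  then show ?case using edges_subset by (auto simp: reach_def)
qed (simp add: reach_0)

lemma finite_reach: "finite (reach r `` {x})"
proof (induction r)
  case (Suc r)
  have "E `` (reach r `` {x}) = (\<Union>y\<in>reach r `` {x}. E `` {y})" by auto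
  then have "finite (E `` (reach r `` {x}))" using Suc finite_neighbours by auto
  then show ?case using Suc by (simp add: reach_Suc_Image)
qed (simp add: reach_0)

lemma sets_reach: "S \<in> sets M \<Longrightarrow> reach r `` S \<in> sets M"
  by (induction r) (auto simp: reach_0 reach_Suc_Image sets_Image)

lemma component_eq_reach: "component E x = (\<Union>r. reach r `` {x})"
proof -
  have "E\<^sup>* = (Id \<union> E)\<^sup>*" by (metis Un_commute rtrancl_reflcl)
  also have "\<dots> = (\<Union>r. reach r)" unfolding reach_def by (rule rtrancl_is_UN_relpow)
  finally show ?thesis by (auto simp: component_def)
qed

text \<open>
  That a label occurs among the points related to \<open>x\<close> means that \<open>x\<close> lies in the \<open>R\<close>-image of a label class.
\<close>

lemma measurable_set_of_labels:
  assumes R: "sym R" "\<And>S. S \<in> sets M \<Longrightarrow> R `` S \<in> sets M" "\<And>x. finite (R `` {x})"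
      "\<And>x y. (x, y) \<in> R \<Longrightarrow> x \<in> space M \<Longrightarrow> y \<in> space M"
    and \<theta>[measurable]: "\<theta> \<in> M \<rightarrow>\<^sub>M count_space UNIV"
  shows "(\<lambda>x. set_encode (\<theta> ` (R `` {x}))) \<in> M \<rightarrow>\<^sub>M count_space UNIV"
proof (rule measurableI_count_space_countable)
  fix p
  have [measurable]: "R `` {y \<in> space M. \<theta> y = l} \<in> sets M" for l
    by (intro R(2)) measurable
  have "set_encode (\<theta> ` (R `` {x})) = p \<longleftrightarrow> (\<forall>l. x \<in> R `` {y \<in> space M. \<theta> y = l} \<longleftrightarrow> l \<in> set_decode p)"
    if x: "x \<in> space M" for x
  proof -
    have "set_encode (\<theta> ` (R `` {x})) = p \<longleftrightarrow> \<theta> ` (R `` {x}) = set_decode p"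
      using R(3)[of x] by (metis finite_imageI set_decode_inverse set_encode_inverse)
    moreover have "l \<in> \<theta> ` (R `` {x}) \<longleftrightarrow> x \<in> R `` {y \<in> space M. \<theta> y = l}" for l
      unfolding mem_sym_Image_iff[OF R(1)] using R(4) x by auto
    ultimately show ?thesis by blast
  qed
  then have "(\<lambda>x. set_encode (\<theta> ` (R `` {x}))) -` {p} \<inter> space M
      = {x \<in> space M. \<forall>l. x \<in> R `` {y \<in> space M. \<theta> y = l} \<longleftrightarrow> l \<in> set_decode p}" by auto
  also have "\<dots> \<in> sets M" by measurable
  finally show "(\<lambda>x. set_encode (\<theta> ` (R `` {x}))) -` {p} \<inter> space M \<in> sets M" .
qed

lemma space_nonempty: "space M \<noteq> {}"
  by (rule not_empty)

lemma separating_labels: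
  "\<exists>k :: nat \<Rightarrow> 'a \<Rightarrow> nat. (\<forall>m. k m \<in> M \<rightarrow>\<^sub>M count_space UNIV) \<and>
     (\<forall>F \<subseteq> space M. finite F \<longrightarrow> (\<exists>m. inj_on (k m) F))"
proof -
  obtain c :: "'a \<Rightarrow> nat \<Rightarrow> real" where c: "c \<in> borel_measurable M" "inj_on c (space M)"
    using standard_borel_embedding[OF standard_borel space_nonempty] by blast
  obtain k :: "nat \<Rightarrow> (nat \<Rightarrow> real) \<Rightarrow> nat" where k: "\<And>m. k m \<in> borel \<rightarrow>\<^sub>M count_space UNIV"
     "\<And>F. finite F \<Longrightarrow> \<exists>m. inj_on (k m) F"
    using finite_separating_labels by metis
  have "\<exists>m. inj_on (k m \<circ> c) F" if F: "F \<subseteq> space M" "finite F" for F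
  proof -
    obtain m where "inj_on (k m) (c ` F)" using k(2)[of "c ` F"] F by auto
    then show ?thesis using comp_inj_on[OF inj_on_subset[OF c(2) F(1)]] by blast
  qed
  moreover have "k m \<circ> c \<in> M \<rightarrow>\<^sub>M count_space UNIV" for m
    by (rule measurable_comp[OF c(1) k(1)])
  ultimately show ?thesis by (intro exI[of _ "\<lambda>m. k m \<circ> c"]) auto
qed

text \<open>
  Each \<open>x\<close> selects the first separating labelling \<open>k m\<close> that is injective on the ball of radius \<open>2 N\<close> around it,
  and \<open>(m, k m x)\<close> becomes its label. If two points of one \<open>N\<close>-ball agree in this label, they use the
  same \<open>m\<close>, and each is in the \<open>2 N\<close>-ball of the other.
\<close>

lemma locally_injective_labelling:
  "\<exists>\<kappa> :: 'a \<Rightarrow> nat. \<kappa> \<in> M \<rightarrow>\<^sub>M count_space UNIV \<and> (\<forall>x\<in>space M. inj_on \<kappa> (reach N `` {x}))"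
proof -
  obtain k :: "nat \<Rightarrow> 'a \<Rightarrow> nat" where k[measurable]: "\<And>m. k m \<in> M \<rightarrow>\<^sub>M count_space UNIV"
    and kinj: "\<And>F. F \<subseteq> space M \<Longrightarrow> finite F \<Longrightarrow> \<exists>m. inj_on (k m) F"
    using separating_labels by metis
  define bad where "bad = (\<lambda>m. {x \<in> space M. \<not> inj_on (k m) (reach (N + N) `` {x})})"
  \<comment> \<open>The points whose ball contains a point with label l under k m and label a under k n.\<close>
  define cls where "cls = (\<lambda>m n l a. reach (N + N) `` {y \<in> space M. k m y = l \<and> k n y = (a :: nat)})"
  have cls[measurable]: "cls m n l a \<in> sets M" for m n l a
    unfolding cls_def by (intro sets_reach) measurable
  have in_cls: "x \<in> cls m n l a \<longleftrightarrow> (\<exists>y\<in>reach (N + N) `` {x}. k m y = l \<and> k n y = a)" if "x \<in> space M" for x m n l a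
    unfolding cls_def mem_sym_Image_iff[OF sym_reach] using that reach_space by auto
  have "bad m = {x \<in> space M. \<exists>n l a b. a \<noteq> b \<and> x \<in> cls m n l a \<and> x \<in> cls m n l b}" for m
  proof (intro equalityI subsetI)
    fix x assume "x \<in> bad m"
    then obtain y z where x: "x \<in> space M" and yz: "y \<in> reach (N + N) `` {x}" "z \<in> reach (N + N) `` {x}"
      "k m y = k m z" "y \<noteq> z" by (auto simp: bad_def inj_on_def)
    have "{y, z} \<subseteq> space M" using yz x reach_space by auto
    then obtain n where "inj_on (k n) {y, z}" using kinj[of "{y, z}"] by auto
    then have "k n y \<noteq> k n z" using yz(4) by (auto simp: inj_on_def)
    then show "x \<in> {x \<in> space M. \<exists>n l a b. a \<noteq> b \<and> x \<in> cls m n l a \<and> x \<in> cls m n l b}"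
      using x yz in_cls[OF x] by fastforce
  next
    fix x assume "x \<in> {x \<in> space M. \<exists>n l a b. a \<noteq> b \<and> x \<in> cls m n l a \<and> x \<in> cls m n l b}"
    then obtain n l a b where x: "x \<in> space M" and ab: "a \<noteq> b" "x \<in> cls m n l a" "x \<in> cls m n l b" by auto
    obtain y z where "y \<in> reach (N + N) `` {x}" "z \<in> reach (N + N) `` {x}" "k m y = k m z" "k n y \<noteq> k n z"
      using ab in_cls[OF x] by metis
    then show "x \<in> bad m" using x unfolding bad_def inj_on_def by blast
  qed
  then have bad[measurable]: "bad m \<in> sets M" for m by simp
  have ex: "\<exists>m. x \<notin> bad m" if "x \<in> space M" for x
  proof -
    have "reach (N + N) `` {x} \<subseteq> space M" using that reach_space by auto
    then show ?thesis using kinj[OF _ finite_reach] by (auto simp: bad_def)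
  qed
  define \<iota> where "\<iota> = (\<lambda>x. LEAST m. x \<notin> bad m)"
  have \<iota>: "x \<notin> bad (\<iota> x)" if "x \<in> space M" for x
    unfolding \<iota>_def using ex[OF that] by (rule LeastI_ex)
  have [measurable]: "\<iota> \<in> M \<rightarrow>\<^sub>M count_space UNIV"
    unfolding \<iota>_def by measurable
  define \<kappa> where "\<kappa> = (\<lambda>x. prod_encode (\<iota> x, k (\<iota> x) x))"
  have "\<kappa> \<in> M \<rightarrow>\<^sub>M count_space UNIV"
  proof (rule measurableI_count_space_countable)
    fix p
    obtain i j where p: "p = prod_encode (i, j)" by (metis prod_decode_inverse surj_pair)
    have "\<kappa> -` {p} \<inter> space M = {x \<in> space M. \<iota> x = i \<and> k i x = j}"
      unfolding p \<kappa>_def by (auto simp: prod_encode_eq)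
    also have "\<dots> \<in> sets M" by measurable
    finally show "\<kappa> -` {p} \<inter> space M \<in> sets M" .
  qed
  moreover have "inj_on \<kappa> (reach N `` {x})" if x: "x \<in> space M" for x
  proof (rule inj_onI)
    fix y z assume yz: "y \<in> reach N `` {x}" "z \<in> reach N `` {x}" "\<kappa> y = \<kappa> z"
    have y: "y \<in> space M" using yz x reach_space by auto
    have eq: "\<iota> y = \<iota> z" "k (\<iota> y) y = k (\<iota> y) z" using yz(3) by (auto simp: \<kappa>_def prod_encode_eq)
    have "(y, x) \<in> reach N" using yz(1) sym_reach[of N] by (auto simp: sym_def)
    then have "z \<in> reach (N + N) `` {y}" using yz(2) by (auto simp: reach_add)
    moreover have "inj_on (k (\<iota> y)) (reach (N + N) `` {y})" using \<iota>[OF y] y by (auto simp: bad_def)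
    ultimately show "y = z" using eq(2) reach_refl[of y "N + N"] by (auto dest: inj_onD)
  qed
  ultimately show ?thesis by blast
qed

end

section \<open>Copying a finitely supported function over the graphing\<close>

text \<open>
  The point \<open>rt\<close> is the centre of the ball to be copied. Radius \<open>r\<close> is that of the support of the functions,
  and the labels are injective two steps further out: one for the images under the Markov operator, and one more to
  identify the neighbours of points at distance \<open>r + 1\<close>.
\<close>

locale graphing_pattern = graphing M E for M :: "'a measure" and E :: "('a \<times> 'a) set" +
  fixes \<kappa> :: "'a \<Rightarrow> nat" and r :: nat and rt :: 'a
  assumes \<kappa>_measurable [measurable]: "\<kappa> \<in> M \<rightarrow>\<^sub>M count_space UNIV"
    and \<kappa>_inj: "x \<in> space M \<Longrightarrow> inj_on \<kappa> (reach (r + 2) `` {x})"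
    and root: "rt \<in> space M"
begin

definition star_label :: "'a \<Rightarrow> nat" where
  "star_label u = prod_encode (\<kappa> u, set_encode (\<kappa> ` (E `` {u})))"

definition view :: "nat \<Rightarrow> 'a \<Rightarrow> nat" where
  "view s x = set_encode (star_label ` (reach s `` {x}))"

text \<open>
  The balls of radius \<open>r\<close> and \<open>r + 1\<close> are recorded separately, so that labels of vertices in the
  support can be recognized as lying at distance at most \<open>r\<close>.
\<close>

definition type_code :: "'a \<Rightarrow> nat" where
  "type_code x = prod_encode (\<kappa> x, prod_encode (view r x, view (Suc r) x))"

definition roots :: "'a set" where
  "roots = {x \<in> space M. type_code x = type_code rt}"

definition copies :: "'a set" where
  "copies = reach (Suc r) `` roots"

definition root_ball :: "'a set" where
  "root_ball = reach (Suc r) `` {rt}"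

definition cell :: "nat \<Rightarrow> 'a set" where
  "cell l = {y \<in> copies. \<kappa> y = l}"

text \<open>
  Unspecified for labels that do not occur in the root ball.
\<close>

definition vertex :: "nat \<Rightarrow> 'a" where
  "vertex l = inv_into root_ball \<kappa> l"

lemma measurable_nbr_labels [measurable]: "(\<lambda>u. set_encode (\<kappa> ` (E `` {u}))) \<in> M \<rightarrow>\<^sub>M count_space UNIV"
  by (rule measurable_set_of_labels) (use sym_edges sets_Image finite_neighbours edges_subset in auto)

lemma measurable_star_label [measurable]: "star_label \<in> M \<rightarrow>\<^sub>M count_space UNIV"
  unfolding star_label_def by measurable

lemma measurable_view [measurable]: "view s \<in> M \<rightarrow>\<^sub>M count_space UNIV"
  unfolding view_def
  by (rule measurable_set_of_labels) (use sym_reach sets_reach finite_reach reach_space in auto)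

lemma measurable_type_code [measurable]: "type_code \<in> M \<rightarrow>\<^sub>M count_space UNIV"
  unfolding type_code_def by measurable

lemma sets_roots [measurable]: "roots \<in> sets M"
  unfolding roots_def by measurable

lemma sets_copies [measurable]: "copies \<in> sets M"
  unfolding copies_def by (intro sets_reach sets_roots)

lemma sets_cell [measurable]: "cell l \<in> sets M"
proof -
  have "cell l = {y \<in> space M. y \<in> copies \<and> \<kappa> y = l}"
    using sets.sets_into_space[OF sets_copies] by (auto simp: cell_def)
  also have "\<dots> \<in> sets M" by measurable
  finally show ?thesis .
qed

lemma finite_root_ball: "finite root_ball"
  by (simp add: root_ball_def finite_reach)

lemma star_label_eqD:
  assumes "star_label u = star_label v"
  shows "\<kappa> u = \<kappa> v" "\<kappa> ` (E `` {u}) = \<kappa> ` (E `` {v})"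
  using assms finite_neighbours[of u] finite_neighbours[of v]
  by (auto simp: star_label_def prod_encode_eq set_encode_eq)

lemma inj_\<kappa>: "x \<in> space M \<Longrightarrow> s \<le> r + 2 \<Longrightarrow> inj_on \<kappa> (reach s `` {x})"
  using \<kappa>_inj[of x] reach_mono[of s "r + 2"] by (meson Image_mono inj_on_subset order_refl)

lemma inj_\<kappa>_neighbours: "x \<in> space M \<Longrightarrow> inj_on \<kappa> (E `` {x})"
  by (rule inj_on_subset[OF inj_\<kappa>[of x 1]]) (auto simp: reach_def)

lemma roots_view:
  assumes "x \<in> roots"
  shows "x \<in> space M" "\<kappa> x = \<kappa> rt"
    "star_label ` (reach r `` {x}) = star_label ` (reach r `` {rt})"
    "star_label ` (reach (Suc r) `` {x}) = star_label ` root_ball"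
proof -
  show x: "x \<in> space M" using assms by (simp add: roots_def)
  have eq: "\<kappa> x = \<kappa> rt" "view r x = view r rt" "view (Suc r) x = view (Suc r) rt"
    using assms by (auto simp: roots_def type_code_def prod_encode_eq)
  show "\<kappa> x = \<kappa> rt" by (rule eq)
  show "star_label ` (reach r `` {x}) = star_label ` (reach r `` {rt})"
    using eq(2) finite_reach unfolding view_def by (metis finite_imageI set_encode_eq)
  show "star_label ` (reach (Suc r) `` {x}) = star_label ` root_ball"
    using eq(3) finite_reach unfolding view_def root_ball_def by (metis finite_imageI set_encode_eq)
qed

lemma roots_labels:
  assumes "x \<in> roots"
  shows "\<kappa> ` (reach r `` {x}) = \<kappa> ` (reach r `` {rt})"
    "\<kappa> ` (reach (Suc r) `` {x}) = \<kappa> ` root_ball"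
proof -
  have k: "\<kappa> ` S = (fst \<circ> prod_decode) ` (star_label ` S)" for S
    by (force simp: star_label_def image_image)
  show "\<kappa> ` (reach r `` {x}) = \<kappa> ` (reach r `` {rt})"
    unfolding k roots_view(3)[OF assms] ..
  show "\<kappa> ` (reach (Suc r) `` {x}) = \<kappa> ` root_ball"
    unfolding k roots_view(4)[OF assms] ..
qed

lemma copiesE:
  assumes "y \<in> copies"
  obtains x where "x \<in> roots" "y \<in> reach (Suc r) `` {x}"
  using assms unfolding copies_def by blast

lemma copies_space: "copies \<subseteq> space M"
  by (rule sets.sets_into_space[OF sets_copies])

lemma root_ball_space: "root_ball \<subseteq> space M"
  using reach_space root by (auto simp: root_ball_def)

lemma vertex_\<kappa>: "u \<in> root_ball \<Longrightarrow> vertex (\<kappa> u) = u"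
  unfolding vertex_def root_ball_def by (intro inv_into_f_f inj_\<kappa> root) auto

text \<open>
  A point \<open>y\<close> near a root occurs, with its label and the labels of its neighbours, in a ball of the same type as
  the root ball.
\<close>

lemma vertex_copy:
  assumes "y \<in> copies"
  shows "vertex (\<kappa> y) \<in> root_ball" "\<kappa> (vertex (\<kappa> y)) = \<kappa> y" "\<kappa> ` (E `` {vertex (\<kappa> y)}) = \<kappa> ` (E `` {y})"
proof -
  obtain x where x: "x \<in> roots" "y \<in> reach (Suc r) `` {x}" using copiesE[OF assms] .
  then have "star_label y \<in> star_label ` root_ball" using roots_view(4)[OF x(1)] by blast
  then obtain u where u: "u \<in> root_ball" "star_label y = star_label u" by blast
  note * = star_label_eqD[OF u(2)]
  have "vertex (\<kappa> y) = u" using vertex_\<kappa>[OF u(1)] *(1) by simp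
  then show "vertex (\<kappa> y) \<in> root_ball" "\<kappa> (vertex (\<kappa> y)) = \<kappa> y" "\<kappa> ` (E `` {vertex (\<kappa> y)}) = \<kappa> ` (E `` {y})"
    using u * by simp_all
qed

lemma vdegree_eq_card_labels: "x \<in> space M \<Longrightarrow> vdegree E x = card (\<kappa> ` (E `` {x}))"
  unfolding vdegree_def by (rule card_image[OF inj_\<kappa>_neighbours, symmetric])

lemma measurable_vdegree: "(\<lambda>x. real (vdegree E x)) \<in> borel_measurable M"
proof -
  have "(\<lambda>x. real (card (set_decode (set_encode (\<kappa> ` (E `` {x})))))) \<in> borel_measurable M"
    by measurable
  moreover have "real (card (set_decode (set_encode (\<kappa> ` (E `` {x}))))) = real (vdegree E x)" if "x \<in> space M" for x
    using finite_neighbours[of x] by (simp add: vdegree_eq_card_labels[OF that] set_encode_inverse)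
  ultimately show ?thesis by (simp cong: measurable_cong)
qed

lemma vdegree_copy: "y \<in> copies \<Longrightarrow> vdegree E y = vdegree E (vertex (\<kappa> y))"
  using vertex_copy[of y] subsetD[OF copies_space, of y] subsetD[OF root_ball_space, of "vertex (\<kappa> y)"]
    vdegree_eq_card_labels[of y] vdegree_eq_card_labels[of "vertex (\<kappa> y)"] by simp

text \<open>
  A ball of the same type already contains a point with the label of \<open>z\<close>, and by injectivity of the
  labels this point is \<open>z\<close>.
\<close>

lemma copies_closed:
  assumes y: "y \<in> copies" and z: "(y, z) \<in> E" and l: "\<kappa> z \<in> \<kappa> ` root_ball"
  shows "z \<in> copies"
proof -
  obtain x where x: "x \<in> roots" "y \<in> reach (Suc r) `` {x}" using copiesE[OF y] .
  obtain z' where z': "z' \<in> reach (Suc r) `` {x}" "\<kappa> z' = \<kappa> z"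
    using l unfolding roots_labels(2)[OF x(1), symmetric] by (metis imageE)
  have "z \<in> reach (r + 2) `` {x}" using reach_step[of x y "Suc r" z] x(2) z by simp
  moreover have "z' \<in> reach (r + 2) `` {x}" using z'(1) reach_mono[of "Suc r" "r + 2"] by auto
  ultimately have "z = z'" using \<kappa>_inj[OF roots_view(1)[OF x(1)]] z'(2) by (auto dest: inj_onD)
  then show ?thesis using z'(1) x(1) by (auto simp: copies_def)
qed

text \<open>
  Every copy of \<open>u\<close> has exactly one neighbour that is a copy of \<open>v\<close>.
\<close>

lemma sum_indicator_cell:
  assumes u: "u \<in> root_ball" and v: "v \<in> root_ball" and uv: "(u, v) \<in> E" and x: "x \<in> cell (\<kappa> u)"
  shows "(\<Sum>z\<in>E `` {x}. indicator (cell (\<kappa> v)) z) = (1 :: real)"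
proof -
  have xc: "x \<in> copies" "\<kappa> x = \<kappa> u" using x by (auto simp: cell_def)
  then have "\<kappa> ` (E `` {x}) = \<kappa> ` (E `` {u})" using vertex_copy(3)[OF xc(1)] vertex_\<kappa>[OF u] by simp
  moreover have "\<kappa> v \<in> \<kappa> ` (E `` {u})" using uv by auto
  ultimately have "\<kappa> v \<in> \<kappa> ` (E `` {x})" by simp
  then obtain z where z: "(x, z) \<in> E" "\<kappa> z = \<kappa> v" by auto
  have "z \<in> copies" by (rule copies_closed[OF xc(1) z(1)]) (use z(2) v in auto)
  then have zcell: "z \<in> cell (\<kappa> v)" using z(2) by (simp add: cell_def)
  have one: "E `` {x} \<inter> cell (\<kappa> v) = {z}"
    using z zcell inj_\<kappa>_neighbours[OF subsetD[OF copies_space xc(1)]] by (auto simp: cell_def inj_on_def)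
  have "(\<Sum>z\<in>E `` {x}. indicator (cell (\<kappa> v)) z) = (\<Sum>z\<in>E `` {x} \<inter> cell (\<kappa> v). indicator (cell (\<kappa> v)) z :: real)"
    using finite_neighbours by (intro sum.mono_neutral_right) (auto simp: indicator_def)
  then show ?thesis using zcell by (simp add: one)
qed

text \<open>
  Let each copy of \<open>u\<close> send mass 1 to its neighbouring copy of \<open>v\<close>. The total mass sent is the measure of
  the copies of \<open>u\<close>, the total mass received is that of the copies of \<open>v\<close>.
\<close>

lemma emeasure_cell_adjacent:
  assumes u: "u \<in> root_ball" and v: "v \<in> root_ball" and uv: "(u, v) \<in> E"
  shows "emeasure M (cell (\<kappa> u)) = emeasure M (cell (\<kappa> v))"
proof -
  define f :: "'a \<times> 'a \<Rightarrow> real" where "f = indicator (cell (\<kappa> u) \<times> cell (\<kappa> v))"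
  have vu: "(v, u) \<in> E" using uv sym_edges by (auto simp: sym_def)
  have outflow: "(\<Sum>y\<in>E `` {x}. ennreal (f (x, y))) = indicator (cell (\<kappa> u)) x" for x
  proof (cases "x \<in> cell (\<kappa> u)")
    case True
    have "(\<Sum>y\<in>E `` {x}. ennreal (f (x, y))) = ennreal (\<Sum>y\<in>E `` {x}. indicator (cell (\<kappa> v)) y)"
      using True by (subst sum_ennreal[symmetric]) (auto simp: f_def indicator_def)
    then show ?thesis using True sum_indicator_cell[OF u v uv True] by simp
  qed (simp add: f_def indicator_def)
  have inflow: "(\<Sum>y\<in>E `` {x}. ennreal (f (y, x))) = indicator (cell (\<kappa> v)) x" for x
  proof (cases "x \<in> cell (\<kappa> v)")
    case True
    have "(\<Sum>y\<in>E `` {x}. ennreal (f (y, x))) = ennreal (\<Sum>y\<in>E `` {x}. indicator (cell (\<kappa> u)) y)"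
      using True by (subst sum_ennreal[symmetric]) (auto simp: f_def indicator_def)
    then show ?thesis using True sum_indicator_cell[OF v u vu True] by simp
  qed (simp add: f_def indicator_def)
  have "f \<in> borel_measurable (restrict_space (M \<Otimes>\<^sub>M M) E)"
    unfolding f_def by (intro measurable_restrict_space1 borel_measurable_indicator pair_measureI sets_cell)
  from mass_transport[OF this] show ?thesis
    unfolding outflow inflow by (simp add: f_def)
qed

text \<open>
  The root ball is connected.
\<close>

lemma emeasure_cell:
  assumes "u \<in> root_ball"
  shows "emeasure M (cell (\<kappa> u)) = emeasure M (cell (\<kappa> rt))"
proof -
  have "emeasure M (cell (\<kappa> u)) = emeasure M (cell (\<kappa> rt))" if "s \<le> Suc r" "u \<in> reach s `` {rt}" for s u
    using that
  proof (induction s arbitrary: u)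
    case (Suc s)
    show ?case
    proof (cases "u \<in> reach s `` {rt}")
      case True
      then show ?thesis using Suc by simp
    next
      case False
      then obtain w where w: "w \<in> reach s `` {rt}" "(w, u) \<in> E"
        using Suc.prems(2) unfolding reach_Suc_Image by blast
      have "w \<in> root_ball" "u \<in> root_ball"
        using w(1) Suc.prems reach_mono[of s "Suc r"] reach_mono[of "Suc s" "Suc r"] by (auto simp: root_ball_def)
      then show ?thesis using emeasure_cell_adjacent[OF _ _ w(2)] Suc.IH[OF _ w(1)] Suc.prems(1) by simp
    qed
  qed (simp add: reach_0)
  then show ?thesis using assms unfolding root_ball_def by blast
qed

lemma roots_subset_cell: "roots \<subseteq> cell (\<kappa> rt)"
proof
  fix x assume x: "x \<in> roots"
  then have "x \<in> copies" using reach_refl[of x "Suc r"] unfolding copies_def by blast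
  then show "x \<in> cell (\<kappa> rt)" using roots_view(2)[OF x] by (simp add: cell_def)
qed

definition copy_measure :: real where
  "copy_measure = measure M (cell (\<kappa> rt))"

lemma copy_measure_pos:
  assumes "emeasure M roots > 0"
  shows "copy_measure > 0"
proof -
  note assms
  also have "emeasure M roots \<le> emeasure M (cell (\<kappa> rt))"
    by (rule emeasure_mono[OF roots_subset_cell sets_cell])
  finally show ?thesis by (simp add: copy_measure_def emeasure_eq_measure)
qed

lemma measure_cell: "u \<in> root_ball \<Longrightarrow> measure M (cell (\<kappa> u)) = copy_measure"
  unfolding copy_measure_def measure_def using emeasure_cell[of u] by simp

text \<open>
  The transplant of \<open>g\<close> to all copies of the root ball. It is well defined even where copies of the ball
  overlap, since the label of \<open>y\<close> alone determines the corresponding vertex.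
\<close>

definition spread :: "('a \<Rightarrow> 'b) \<Rightarrow> 'a \<Rightarrow> 'b::zero" where
  "spread g y = (if y \<in> copies then g (vertex (\<kappa> y)) else 0)"

lemma measurable_spread: "spread g \<in> borel_measurable M"
proof -
  have "(\<lambda>y. g (vertex (\<kappa> y))) \<in> borel_measurable M"
    by (rule measurable_compose[OF \<kappa>_measurable]) simp
  then show ?thesis unfolding spread_def[abs_def] by measurable
qed

lemma integral_spread:
  fixes g :: "'a \<Rightarrow> real"
  shows "integrable M (spread g)" "(\<integral>y. spread g y \<partial>M) = copy_measure * (\<Sum>u\<in>root_ball. g u)"
proof -
  have eq: "spread g y = (\<Sum>u\<in>root_ball. g u * indicator (cell (\<kappa> u)) y)" for y
  proof (cases "y \<in> copies")
    case True
    have "(\<Sum>u\<in>root_ball. g u * indicator (cell (\<kappa> u)) y) = (\<Sum>u\<in>root_ball. if u = vertex (\<kappa> y) then g u else 0)"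
    proof (rule sum.cong[OF refl])
      fix u assume u: "u \<in> root_ball"
      have "\<kappa> y = \<kappa> u \<longleftrightarrow> u = vertex (\<kappa> y)" using vertex_\<kappa>[OF u] vertex_copy(2)[OF True] by metis
      then show "g u * indicator (cell (\<kappa> u)) y = (if u = vertex (\<kappa> y) then g u else 0)"
        using True by (auto simp: cell_def indicator_def)
    qed
    also have "\<dots> = g (vertex (\<kappa> y))" using vertex_copy(1)[OF True] finite_root_ball by simp
    finally show ?thesis using True by (simp add: spread_def)
  qed (auto simp: spread_def cell_def indicator_def)
  have int: "integrable M (\<lambda>y. g u * indicator (cell (\<kappa> u)) y)" for u
    by (intro integrable_mult_right integrable_real_indicator) (auto simp: emeasure_eq_measure)
  show "integrable M (spread g)" unfolding eq[abs_def] by (intro Bochner_Integration.integrable_sum int)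
  have "(\<integral>y. spread g y \<partial>M) = (\<Sum>u\<in>root_ball. \<integral>y. g u * indicator (cell (\<kappa> u)) y \<partial>M)"
    unfolding eq by (rule Bochner_Integration.integral_sum[OF int])
  also have "\<dots> = (\<Sum>u\<in>root_ball. g u * copy_measure)"
    using measure_cell sets.sets_into_space[OF sets_cell]
    by (intro sum.cong) (auto simp: Int_absorb2)
  finally show "(\<integral>y. spread g y \<partial>M) = copy_measure * (\<Sum>u\<in>root_ball. g u)"
    by (simp add: sum_distrib_right[symmetric] mult.commute)
qed

lemma spread_in_L2:
  fixes g :: "'a \<Rightarrow> complex"
  shows "spread g \<in> L2 (degree_biased M E)"
    "(L2norm (degree_biased M E) (spread g))\<^sup>2
       = copy_measure / (\<integral>z. real (vdegree E z) \<partial>M) * (\<Sum>u\<in>root_ball. (cmod (g u))\<^sup>2 * real (vdegree E u))"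
proof -
  define Z where "Z = (\<integral>z. real (vdegree E z) \<partial>M)"
  have Z: "Z \<ge> 0" by (simp add: Z_def)
  have m: "(\<lambda>x. real (vdegree E x) / Z) \<in> borel_measurable M" using measurable_vdegree by measurable
  have m2: "(\<lambda>y. (cmod (spread g y))\<^sup>2) \<in> borel_measurable M" using measurable_spread[of g] by measurable
  have eq: "(real (vdegree E y) / Z) *\<^sub>R (cmod (spread g y))\<^sup>2
      = spread (\<lambda>u. (cmod (g u))\<^sup>2 * real (vdegree E u) / Z) y" for y
    using vdegree_copy[of y] by (simp add: spread_def)
  have nn: "AE x in M. 0 \<le> real (vdegree E x) / Z" using Z by simp
  have "integrable (degree_biased M E) (\<lambda>y. (cmod (spread g y))\<^sup>2)"
    unfolding degree_biased_def Z_def[symmetric] integrable_density[OF m2 m nn] eq by (rule integral_spread(1))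
  then show "spread g \<in> L2 (degree_biased M E)"
    using measurable_spread[of g] by (simp add: L2_def degree_biased_def)
  have nn2: "0 \<le> (\<integral>y. (cmod (spread g y))\<^sup>2 \<partial>degree_biased M E)" by simp
  have "(\<integral>y. (cmod (spread g y))\<^sup>2 \<partial>degree_biased M E) = copy_measure * (\<Sum>u\<in>root_ball. (cmod (g u))\<^sup>2 * real (vdegree E u) / Z)"
    unfolding degree_biased_def Z_def[symmetric] integral_density[OF m2 m nn] eq by (rule integral_spread(2))
  then show "(L2norm (degree_biased M E) (spread g))\<^sup>2
       = copy_measure / (\<integral>z. real (vdegree E z) \<partial>M) * (\<Sum>u\<in>root_ball. (cmod (g u))\<^sup>2 * real (vdegree E u))"
    unfolding Z_def[symmetric] L2norm_def real_sqrt_pow2[OF nn2] by (simp add: sum_divide_distrib[symmetric])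
qed

text \<open>
  A copy of \<open>u\<close> has the same neighbouring labels as \<open>u\<close>, and the values of \<open>spread g\<close> and \<open>g\<close> on neighbours
  are the same function of the label. Outside the copies both sides vanish: a neighbour in the support has
  distance at most \<open>r\<close> from a root.
\<close>

lemma markov_op_spread:
  assumes supp: "\<And>u. g u \<noteq> 0 \<Longrightarrow> u \<in> reach r `` {rt}"
  shows "markov_op E (spread g) = spread (markov_op E g)"
proof
  fix y
  show "markov_op E (spread g) y = spread (markov_op E g) y"
  proof (cases "y \<in> copies")
    case True
    define u where "u = vertex (\<kappa> y)"
    have u: "u \<in> root_ball" "\<kappa> ` (E `` {u}) = \<kappa> ` (E `` {y})"
      using vertex_copy[OF True] by (auto simp: u_def)
    have uM: "u \<in> space M" and yM: "y \<in> space M" using u root_ball_space True copies_space by auto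
    \<comment> \<open>The common value on neighbours as a function of the label, 0 for labels foreign to the root ball.\<close>
    define h where "h = (\<lambda>l. if l \<in> \<kappa> ` root_ball then g (vertex l) else 0)"
    have "spread g z = h (\<kappa> z)" if "z \<in> E `` {y}" for z
    proof (cases "z \<in> copies")
      case z: True
      have "\<kappa> z \<in> \<kappa> ` root_ball" using vertex_copy[OF z] by (metis imageI)
      then show ?thesis using z by (simp add: spread_def h_def)
    next
      case False
      then have "\<kappa> z \<notin> \<kappa> ` root_ball" using copies_closed[OF True] that by auto
      then show ?thesis using False by (simp add: spread_def h_def)
    qed
    then have "(\<Sum>z\<in>E `` {y}. spread g z) = (\<Sum>z\<in>E `` {y}. h (\<kappa> z))" by (rule sum.cong[OF refl])
    also have "\<dots> = (\<Sum>l\<in>\<kappa> ` (E `` {y}). h l)"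
      using inj_\<kappa>_neighbours[OF yM] by (simp add: sum.reindex)
    also have "\<dots> = (\<Sum>z\<in>E `` {u}. h (\<kappa> z))"
      unfolding u(2)[symmetric] using inj_\<kappa>_neighbours[OF uM] by (simp add: sum.reindex)
    also have "\<dots> = (\<Sum>z\<in>E `` {u}. g z)"
    proof (rule sum.cong[OF refl])
      fix z assume z: "z \<in> E `` {u}"
      show "h (\<kappa> z) = g z"
      proof (cases "z \<in> root_ball")
        case True
        then show ?thesis by (simp add: h_def vertex_\<kappa>)
      next
        case False
        have "z \<in> reach (r + 2) `` {rt}" using reach_step[of rt u "Suc r" z] u(1) z by (simp add: root_ball_def)
        moreover have "root_ball \<subseteq> reach (r + 2) `` {rt}"
          using reach_mono[of "Suc r" "r + 2"] by (auto simp: root_ball_def)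
        ultimately have "\<kappa> z \<notin> \<kappa> ` root_ball" using False \<kappa>_inj[OF root] by (auto dest: inj_onD)
        moreover have "g z = 0"
          using supp[of z] False reach_mono[of r "Suc r"] by (auto simp: root_ball_def)
        ultimately show ?thesis by (simp add: h_def)
      qed
    qed
    finally show ?thesis
      using True vdegree_copy[OF True] by (simp add: markov_op_def spread_def u_def)
  next
    case False
    have "spread g z = 0" if z: "z \<in> E `` {y}" for z
    proof (rule ccontr)
      assume nz: "spread g z \<noteq> 0"
      then have zc: "z \<in> copies" and "g (vertex (\<kappa> z)) \<noteq> 0" by (auto simp: spread_def split: if_splits)
      then have "\<kappa> (vertex (\<kappa> z)) \<in> \<kappa> ` (reach r `` {rt})" using supp by blast
      then have l: "\<kappa> z \<in> \<kappa> ` (reach r `` {rt})" using vertex_copy(2)[OF zc] by simp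
      obtain x where x: "x \<in> roots" "z \<in> reach (Suc r) `` {x}" using copiesE[OF zc] .
      obtain z' where z': "z' \<in> reach r `` {x}" "\<kappa> z' = \<kappa> z"
        using l unfolding roots_labels(1)[OF x(1), symmetric] by (metis imageE)
      have "z' \<in> reach (Suc r) `` {x}" using z'(1) reach_mono[of r "Suc r"] by auto
      then have "z = z'" using inj_\<kappa>[OF roots_view(1)[OF x(1)], of "Suc r"] x(2) z'(2) by (auto dest: inj_onD)
      moreover have "(z, y) \<in> E" using z sym_edges by (auto simp: sym_def)
      ultimately have "y \<in> reach (Suc r) `` {x}" using reach_step[of x z r y] z'(1) by auto
      then show False using False x(1) by (auto simp: copies_def)
    qed
    then show ?thesis using False by (simp add: markov_op_def spread_def)
  qed
qed

text \<open>
  The test function is the transplant of \<open>g\<close>; the factor \<open>copy_measure\<close> divided by the mean degree is common to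
  both sides.
\<close>

lemma energy_bound:
  assumes supp: "\<And>u. g u \<noteq> 0 \<Longrightarrow> u \<in> reach r `` {rt}"
    and pos: "emeasure M roots > 0" and Z: "(\<integral>z. real (vdegree E z) \<partial>M) > 0"
    and C: "\<And>f. f \<in> L2 (degree_biased M E) \<Longrightarrow> (\<lambda>y. c * f y - markov_op E f y) \<in> L2 (degree_biased M E) \<Longrightarrow>
       L2norm (degree_biased M E) f \<le> C * L2norm (degree_biased M E) (\<lambda>y. c * f y - markov_op E f y)"
  shows "(\<Sum>u\<in>root_ball. (cmod (g u))\<^sup>2 * real (vdegree E u))
     \<le> C\<^sup>2 * (\<Sum>u\<in>root_ball. (cmod (c * g u - markov_op E g u))\<^sup>2 * real (vdegree E u))"
proof -
  define b where "b = copy_measure / (\<integral>z. real (vdegree E z) \<partial>M)"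
  have b: "b > 0" using copy_measure_pos[OF pos] Z by (simp add: b_def)
  have commute: "markov_op E (spread g) = spread (markov_op E g)"
    by (rule markov_op_spread) (rule supp)
  have eq: "(\<lambda>y. c * spread g y - markov_op E (spread g) y) = spread (\<lambda>u. c * g u - markov_op E g u)"
    unfolding commute by (rule ext) (simp add: spread_def)
  have "L2norm (degree_biased M E) (spread g) \<le> C * L2norm (degree_biased M E) (spread (\<lambda>u. c * g u - markov_op E g u))"
    using C[of "spread g"] unfolding eq by (simp add: spread_in_L2(1))
  moreover have "0 \<le> L2norm (degree_biased M E) (spread g)" by (simp add: L2norm_def)
  ultimately have "(L2norm (degree_biased M E) (spread g))\<^sup>2 \<le> (C * L2norm (degree_biased M E) (spread (\<lambda>u. c * g u - markov_op E g u)))\<^sup>2"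
    by (rule power_mono)
  then have "b * (\<Sum>u\<in>root_ball. (cmod (g u))\<^sup>2 * real (vdegree E u))
     \<le> b * (C\<^sup>2 * (\<Sum>u\<in>root_ball. (cmod (c * g u - markov_op E g u))\<^sup>2 * real (vdegree E u)))"
    unfolding power_mult_distrib spread_in_L2(2) b_def by (simp add: mult_ac)
  then show ?thesis using b by simp
qed

end

section \<open>Comparison of the two spectra\<close>

text \<open>
  A bounded left inverse of \<open>c I - \<M>\<close> bounds the operator from below.
\<close>

lemma (in graphing) resolvent_bounded_below:
  assumes "c \<notin> graphing_spectrum M E"
  shows "\<exists>C. \<forall>f \<in> L2 (degree_biased M E). (\<lambda>y. c * f y - markov_op E f y) \<in> L2 (degree_biased M E) \<longrightarrow>
     L2norm (degree_biased M E) f \<le> C * L2norm (degree_biased M E) (\<lambda>y. c * f y - markov_op E f y)"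
proof -
  define P where "P = degree_biased M E"
  obtain S where S: "bounded_L2_operator P S"
    and inv: "\<And>f. f \<in> L2 P \<Longrightarrow> AE x in P. S (\<lambda>y. c * f y - markov_op E f y) x = f x"
    using assms unfolding graphing_spectrum_def L2_spectrum_def P_def by blast
  obtain C where C: "\<And>f. f \<in> L2 P \<Longrightarrow> L2norm P (S f) \<le> C * L2norm P f"
    using S unfolding bounded_L2_operator_def by blast
  have SL2: "S f \<in> L2 P" if "f \<in> L2 P" for f
    using S that unfolding bounded_L2_operator_def by blast
  have "L2norm P f \<le> C * L2norm P (\<lambda>y. c * f y - markov_op E f y)"
    if f: "f \<in> L2 P" and g: "(\<lambda>y. c * f y - markov_op E f y) \<in> L2 P" for f
  proof -
    have "AE x in P. (cmod (f x))\<^sup>2 = (cmod (S (\<lambda>y. c * f y - markov_op E f y) x))\<^sup>2"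
      using inv[OF f] by eventually_elim simp
    then have "L2norm P f = L2norm P (S (\<lambda>y. c * f y - markov_op E f y))"
      unfolding L2norm_def using f SL2[OF g] by (intro arg_cong[of _ _ sqrt] integral_cong_AE) (auto simp: L2_def)
    then show ?thesis using C[OF g] by simp
  qed
  then show ?thesis unfolding P_def by blast
qed

context graphing
begin

lemma component_countable: "countable (component E x)"
  unfolding component_eq_reach using finite_reach by (auto intro: countable_finite)

lemma component_closed: "u \<in> component E x \<Longrightarrow> (u, v) \<in> E \<Longrightarrow> v \<in> component E x"
  by (auto simp: component_def intro: rtrancl_into_rtrancl)

lemma component_edges_Image: "u \<in> component E x \<Longrightarrow> component_edges E x `` {u} = E `` {u}"
  using component_closed by (auto simp: component_edges_def)

lemma infinite_component_nonisolated:
  assumes inf: "infinite (component E x)" and u: "u \<in> component E x"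
  shows "E `` {u} \<noteq> {}"
proof
  assume iso: "E `` {u} = {}"
  have "sym (E\<^sup>*)" using sym_edges by (rule sym_rtrancl)
  then have "(u, x) \<in> E\<^sup>*" using u by (auto simp: component_def dest: symD)
  then have "x = u" using iso by (auto elim: converse_rtranclE)
  moreover have "component E u = {u}" using iso by (auto simp: component_def elim: converse_rtranclE)
  ultimately show False using inf by simp
qed

lemma finite_subset_component:
  assumes "finite S" "S \<subseteq> component E x"
  shows "\<exists>r. S \<subseteq> reach r `` {x}"
  using assms
proof (induction S rule: finite_induct)
  case (insert u S)
  then obtain r s where "S \<subseteq> reach r `` {x}" "u \<in> reach s `` {x}"
    unfolding component_eq_reach by auto
  then have "insert u S \<subseteq> reach (max r s) `` {x}"
    using reach_mono[of r "max r s"] reach_mono[of s "max r s"] by auto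
  then show ?case ..
qed simp

text \<open>
  A finitely supported function on the component is supported in some ball, to which the transfer of the
  estimate applies; the constant is the same for all radii.
\<close>

lemma component_spectrum_subset:
  assumes x: "x \<in> space M" and inf: "infinite (component E x)"
    and Z: "(\<integral>z. real (vdegree E z) \<partial>M) > 0"
    and \<kappa>: "\<And>r. graphing_pattern M E (\<kappa> r) r x"
    and pos: "\<And>r. emeasure M (graphing_pattern.roots M E (\<kappa> r) r x) > 0"
  shows "graph_spectrum (component E x) (component_edges E x) \<subseteq> graphing_spectrum M E"
proof (rule subsetI, rule ccontr)
  fix c
  assume c: "c \<in> graph_spectrum (component E x) (component_edges E x)" and "c \<notin> graphing_spectrum M E"
  then obtain C where C: "\<And>f. f \<in> L2 (degree_biased M E) \<Longrightarrow> (\<lambda>y. c * f y - markov_op E f y) \<in> L2 (degree_biased M E) \<Longrightarrow>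
       L2norm (degree_biased M E) f \<le> C * L2norm (degree_biased M E) (\<lambda>y. c * f y - markov_op E f y)"
    using resolvent_bounded_below by blast
  define V where "V = component E x"
  define G where "G = component_edges E x"
  have GE: "G `` {u} = E `` {u}" if "u \<in> V" for u
    using that component_edges_Image by (simp add: G_def V_def)
  interpret G: locally_finite_graph V G
  proof
    show "countable V" by (simp add: V_def component_countable)
    show "G \<subseteq> V \<times> V" by (auto simp: G_def V_def component_edges_def)
    show "sym G" using sym_edges by (auto simp: G_def component_edges_def sym_def)
    show "finite (G `` {u})" "G `` {u} \<noteq> {}" if "u \<in> V" for u
      using that infinite_component_nonisolated[OF inf] finite_neighbours by (auto simp: GE V_def)
  qed
  have deg: "vdegree G u = vdegree E u" if "u \<in> V" for u using GE[OF that] by (simp add: vdegree_def)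
  have res: "resolvent_op G c f u = c * f u - markov_op E f u" if "u \<in> V" for f u
    using GE[OF that] by (simp add: resolvent_op_def markov_op_def vdegree_def)
  have "c \<notin> graph_spectrum V G"
  proof (rule G.not_in_graph_spectrum[where K = "max 1 (C\<^sup>2)"])
    fix f :: "'a \<Rightarrow> complex" and F
    assume F: "finite F" "F \<subseteq> V" "{u. f u \<noteq> 0} \<union> G `` {u. f u \<noteq> 0} \<subseteq> F"
    have "finite {u. f u \<noteq> 0}" "{u. f u \<noteq> 0} \<subseteq> V" using F by (auto intro: finite_subset)
    then obtain r where r: "{u. f u \<noteq> 0} \<subseteq> reach r `` {x}"
      using finite_subset_component unfolding V_def by blast
    interpret P: graphing_pattern M E "\<kappa> r" r x by (rule \<kappa>)
    define B where "B = P.root_ball"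
    have BV: "B \<subseteq> V" unfolding B_def P.root_ball_def V_def component_eq_reach by auto
    have finB: "finite B" unfolding B_def by (rule P.finite_root_ball)
    have suppB: "{u. f u \<noteq> 0} \<union> G `` {u. f u \<noteq> 0} \<subseteq> B"
    proof -
      have "{u. f u \<noteq> 0} \<subseteq> B" using r reach_mono[of r "Suc r"] by (auto simp: B_def P.root_ball_def)
      moreover have "G `` {u. f u \<noteq> 0} \<subseteq> B"
        using r reach_step[of x _ r] by (auto simp: B_def P.root_ball_def G_def component_edges_def)
      ultimately show ?thesis by blast
    qed
    have move: "G.energy F h = G.energy B h" if h0: "\<And>u. u \<notin> {u. f u \<noteq> 0} \<union> G `` {u. f u \<noteq> 0} \<Longrightarrow> h u = 0" for h
    proof -
      have "h u = 0" if "u \<notin> F \<or> u \<notin> B" for u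
        using h0[of u] that F(3) suppB by blast
      then have "G.energy (F \<union> B) h = G.energy F h" "G.energy (F \<union> B) h = G.energy B h"
        using F(1) finB by (auto intro!: G.energy_superset_support)
      then show ?thesis by simp
    qed
    have bound: "(\<Sum>u\<in>P.root_ball. (cmod (f u))\<^sup>2 * real (vdegree E u))
        \<le> C\<^sup>2 * (\<Sum>u\<in>P.root_ball. (cmod (c * f u - markov_op E f u))\<^sup>2 * real (vdegree E u))"
    proof (rule P.energy_bound[OF _ pos Z C])
      show "u \<in> reach r `` {x}" if "f u \<noteq> 0" for u using r that by blast
    qed
    have "G.energy F f = G.energy B f" by (rule move) auto
    also have "\<dots> = (\<Sum>u\<in>B. (cmod (f u))\<^sup>2 * real (vdegree E u))"
      unfolding G.energy_def using BV deg by (intro sum.cong) auto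
    also have "\<dots> \<le> C\<^sup>2 * (\<Sum>u\<in>B. (cmod (c * f u - markov_op E f u))\<^sup>2 * real (vdegree E u))"
      using bound by (simp add: B_def)
    also have "(\<Sum>u\<in>B. (cmod (c * f u - markov_op E f u))\<^sup>2 * real (vdegree E u)) = G.energy B (resolvent_op G c f)"
      unfolding G.energy_def using BV deg res by (intro sum.cong) auto
    also have "\<dots> = G.energy F (resolvent_op G c f)"
      by (rule move[symmetric], rule G.resolvent_op_support[of "{u. f u \<noteq> 0}"]) auto
    also have "C\<^sup>2 * G.energy F (resolvent_op G c f) \<le> max 1 (C\<^sup>2) * G.energy F (resolvent_op G c f)"
      by (intro mult_right_mono G.energy_nonneg) auto
    finally show "G.energy F f \<le> max 1 (C\<^sup>2) * G.energy F (resolvent_op G c f)" .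
  qed simp
  then show False using c by (simp add: V_def G_def)
qed

text \<open>
  Infinite components have no isolated vertices, so the degree is almost surely at least 1.
\<close>

lemma mean_degree_pos:
  assumes "aperiodic M E"
  shows "(\<integral>z. real (vdegree E z) \<partial>M) > 0"
proof -
  obtain x where x: "x \<in> space M" using space_nonempty by auto
  obtain \<kappa> :: "'a \<Rightarrow> nat" where \<kappa>: "\<kappa> \<in> M \<rightarrow>\<^sub>M count_space UNIV" "\<And>x. x \<in> space M \<Longrightarrow> inj_on \<kappa> (reach (0 + 2) `` {x})"
    using locally_injective_labelling[of "0 + 2"] by blast
  \<comment> \<open>Any pattern will do here: the labels serve to show that the degree is Borel.\<close>
  interpret graphing_pattern M E \<kappa> 0 x by unfold_locales (use \<kappa> x in auto)
  obtain D where D: "\<And>x. x \<in> space M \<Longrightarrow> vdegree E x \<le> D" using bounded_degree by blast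
  have int: "integrable M (\<lambda>z. real (vdegree E z))"
    by (rule integrable_const_bound[of _ "real D"]) (use D measurable_vdegree in auto)
  have "AE z in M. 1 \<le> real (vdegree E z)"
    using assms unfolding aperiodic_def
  proof eventually_elim
    fix z assume "infinite (component E z)"
    then have "E `` {z} \<noteq> {}" by (rule infinite_component_nonisolated) (simp add: component_def)
    then have "vdegree E z > 0" using finite_neighbours[of z] by (simp add: vdegree_def card_gt_0_iff)
    then show "1 \<le> real (vdegree E z)" by simp
  qed
  then have "(\<integral>z. 1 \<partial>M) \<le> (\<integral>z. real (vdegree E z) \<partial>M)"
    by (intro integral_mono_AE int) auto
  then show ?thesis by (simp add: prob_space)
qed

end

theorem corollary3p2:
  fixes M :: "'a measure" and E :: "('a \<times> 'a) set"
  assumes "graphing M E"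
    and "aperiodic M E"
    and "ergodic M E"
  shows "AE x in M. graph_spectrum (component E x) (component_edges E x) \<subseteq> graphing_spectrum M E"
proof -
  interpret graphing M E by (rule assms(1))
  have "\<forall>r. \<exists>\<kappa> :: 'a \<Rightarrow> nat. \<kappa> \<in> M \<rightarrow>\<^sub>M count_space UNIV \<and> (\<forall>x\<in>space M. inj_on \<kappa> (reach (r + 2) `` {x}))"
    using locally_injective_labelling by blast
  then obtain \<kappa> :: "nat \<Rightarrow> 'a \<Rightarrow> nat" where \<kappa>: "\<And>r. \<kappa> r \<in> M \<rightarrow>\<^sub>M count_space UNIV"
      "\<And>r x. x \<in> space M \<Longrightarrow> inj_on (\<kappa> r) (reach (r + 2) `` {x})"
    by metis
  have pat: "graphing_pattern M E (\<kappa> r) r x" if "x \<in> space M" for r x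
    by unfold_locales (use \<kappa> that in auto)
  obtain x0 where x0: "x0 \<in> space M" using space_nonempty by auto
  define \<tau> where "\<tau> = (\<lambda>r. graphing_pattern.type_code E (\<kappa> r) r)"
  \<comment> \<open>The type of a point does not involve the centre of the pattern, so a single centre settles measurability.\<close>
  have "AE x in M. \<forall>r. emeasure M {y \<in> space M. \<tau> r y = \<tau> r x} > 0"
    unfolding AE_all_countable \<tau>_def
    using graphing_pattern.measurable_type_code[OF pat[OF x0]] by (intro allI AE_positive_label_class)
  moreover have "AE x in M. infinite (component E x)" using assms(2) by (simp add: aperiodic_def)
  ultimately show ?thesis
    using AE_space
  proof eventually_elim
    fix x assume pos: "\<forall>r. emeasure M {y \<in> space M. \<tau> r y = \<tau> r x} > 0"
      and inf: "infinite (component E x)" and x: "x \<in> space M"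
    show "graph_spectrum (component E x) (component_edges E x) \<subseteq> graphing_spectrum M E"
    proof (rule component_spectrum_subset[OF x inf mean_degree_pos[OF assms(2)] pat[OF x]])
      show "emeasure M (graphing_pattern.roots M E (\<kappa> r) r x) > 0" for r
        unfolding graphing_pattern.roots_def[OF pat[OF x]] using pos by (simp add: \<tau>_def)
    qed
  qed
qed

end
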